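(* Suppose Assumptions A and B (see context) hold, the mapping $F$ is strictly monotone over $X$, and the variational inequality problem VI$(X,F)$ has the weak-sharpness property with parameter $\alpha>0$. Let $\beta$ be a constant with $$\beta>\max\Big\{\sqrt{5n}\,C,\ \frac{\alpha^2-5(C^2+\nu^2)}{2\sqrt{n}\,C}\Big\},$$ and set $$q=\alpha+2C^2\alpha+2\alpha\nu^2+2(\alpha+1)\beta\sqrt{n}\,C+5(C^2+\nu^2).$$ Let $\{x_t\}$ be generated by the stochastic extragradient scheme $$y_{t+1}=\Pi_X[x_t-\gamma_t\Phi(x_t+z_t',\xi_t')],\qquad x_{t+1}=\Pi_X[x_t-\gamma_t\Phi(y_{t+1}+z_t,\xi_t)],\qquad t\ge0,$$ where the stepsizes $\gamma_t$ and smoothing parameters $\epsilon_t$ are given by $$\gamma_0=\frac{2\alpha M}{q},\quad \gamma_{t+1}=\gamma_t\Big(1-\frac{\alpha}{2M}\gamma_t\Big),\qquad \epsilon_0=\frac{2\alpha\beta M}{q},\quad \epsilon_{t+1}=\epsilon_t\Big(1-\frac{\alpha}{2\beta M}\epsilon_t\Big),\qquad t\ge0.$$ Then VI$(X,F)$ has a unique solution $x^*$, and: (a) $x_t\to x^*$ almost surely as $t\to\infty$. (b) $x_t$ converges to $x^*$ in the mean-squared sense; more precisely, $$\mathsf{E}[\|x_t-x^*\|^2]\le\Big(\frac{4qM^2}{\alpha^2}\Big)\frac1t\qquad\text{for all }t\ge1.$$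
   Context: $\|\cdot\|$ is the Euclidean norm on $\mathbb{R}^n$, and $\Pi_X$ is the Euclidean projection onto $X$. Setting: $X\subset\mathbb{R}^n$ is nonempty; $\xi:\Omega\to\mathbb{R}^d$ is a random variable on a probability space $(\Omega,\mathcal{F},\mathbb{P})$. For $\epsilon>0$ put $C_n(0,\epsilon)=\{x\in\mathbb{R}^n: x_i\in[-\epsilon/2,\epsilon/2]\ \forall i\}$ and $X^\epsilon=X+C_n(0,\epsilon)$. Here $\epsilon$ is a fixed upper bound of the positive sequence $\{\epsilon_t\}$. The stochastic mapping $\Phi(x,\xi)\in\mathbb{R}^n$ is defined for $x\in X^\epsilon$, and $F(x)=\mathsf{E}[\Phi(x,\xi)]$ for $x\in X^\epsilon$. A solution of VI$(X,F)$ is a point $x^*\in X$ with $F(x^* )^T(x-x^* )\ge0$ for all $x\in X$. Algorithm data: $x_0$ is a random initial point in $X$ with $\mathsf{E}[\|x_0\|^2]<\infty$. For each $t\ge0$, $\xi_t,\xi_t'$ are i.i.d. samples of $\xi$, and $z_t,z_t'$ are i.i.d. samples of $Z_t$, which is uniformly distributed over the cube $C_n(0,\epsilon_t)$ (independent coordinates, each uniform on $[-\epsilon_t/2,\epsilon_t/2]$). Assumption A: (a) $X$ is closed, convex and bounded, with $\|x\|\le M$ for all $x\in X$ and some $M>0$. (b) $F$ is monotone on $X^\epsilon$, i.e. $(F(x)-F(y))^T(x-y)\ge0$ for all $x,y\in X^\epsilon$, and $\|F(x)\|\le C$ for all $x\in X^\epsilon$ and some $C>0$. (c) There exists $x^*\in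 X$ with $(x-x^* )^T\mathsf{E}[\Phi(x^*,\xi)]\ge0$ for all $x\in X$. (d) All the random variables $z_t,z_t',\xi_k,\xi_k'$ ($t,k\ge0$) are independent of each other and of $x_0$. Assumption B: with $w(x)=\Phi(x,\xi)-F(x)$, one has $\mathsf{E}[w(x)]=0$ and $\mathsf{E}[\|w(x)\|^2]\le\nu^2$ for all $x\in X^\epsilon$ and some $\nu>0$. Strict monotonicity over $X$: $(F(x)-F(y))^T(x-y)>0$ for all $x\ne y$ in $X$. Weak-sharpness: let $F:X\to\mathbb{R}^n$ be continuous and let $X^*$ be the solution set of VI$(X,F)$. The problem has the weak-sharpness property with parameter $\alpha>0$ if $F(x^* )^T(x-x^* )\ge\alpha\,\mathrm{dist}(x,X^* )$ for all $x\in X$ and all $x^*\in X^*$, where $\mathrm{dist}(x,X^* )=\inf_{u\in X^*}\|x-u\|$. *)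

theory Defs
  imports "HOL-Probability.Probability"
begin

definition cube :: "real \<Rightarrow> (real ^ 'n) set" where
  "cube \<epsilon> = {u. \<forall>i. u $ i \<in> {- \<epsilon> / 2 .. \<epsilon> / 2}}"

definition enlargement :: "(real ^ 'n) set \<Rightarrow> real \<Rightarrow> (real ^ 'n) set" where
  "enlargement X \<epsilon> = {x + u | x u. x \<in> X \<and> u \<in> cube \<epsilon>}"

(* Monotonicity of vector-valued mappings; the library's monotone_on and strict_mono_on are
   order-theoretic and unrelated. *)
definition monotone_map_on :: "'a::real_inner set \<Rightarrow> ('a \<Rightarrow> 'a) \<Rightarrow> bool" where
  "monotone_map_on S F \<longleftrightarrow> (\<forall>x\<in>S. \<forall>y\<in>S. (F x - F y) \<bullet> (x - y) \<ge> 0)"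

definition strictly_monotone_map_on :: "'a::real_inner set \<Rightarrow> ('a \<Rightarrow> 'a) \<Rightarrow> bool" where
  "strictly_monotone_map_on S F \<longleftrightarrow> (\<forall>x\<in>S. \<forall>y\<in>S. x \<noteq> y \<longrightarrow> (F x - F y) \<bullet> (x - y) > 0)"

definition VI_solutions :: "'a::real_inner set \<Rightarrow> ('a \<Rightarrow> 'a) \<Rightarrow> 'a set" where
  "VI_solutions X F = {s \<in> X. \<forall>x\<in>X. F s \<bullet> (x - s) \<ge> 0}"

definition weakly_sharp :: "'a::real_inner set \<Rightarrow> ('a \<Rightarrow> 'a) \<Rightarrow> real \<Rightarrow> bool" where
  "weakly_sharp X F \<alpha> \<longleftrightarrow> continuous_on X F \<and>
     (\<forall>x\<in>X. \<forall>s\<in>VI_solutions X F. F s \<bullet> (x - s) \<ge> \<alpha> * infdist x (VI_solutions X F))"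

(* Mutual independence of x0 and the four sample sequences. They take values in two different
   types, so indep_vars does not apply to the whole family; instead the sigma-algebras they
   generate are required to be independent, which is what indep_vars amounts to. *)
datatype source = Start | Z nat | Z' nat | Xi nat | Xi' nat

definition generated_events :: "'w measure \<Rightarrow> ('w \<Rightarrow> 'a::topological_space) \<Rightarrow> 'w set set" where
  "generated_events P V = sets (vimage_algebra (space P) V borel)"

definition independent_sources ::
  "'w measure \<Rightarrow> ('w \<Rightarrow> real ^ 'n) \<Rightarrow> (nat \<Rightarrow> 'w \<Rightarrow> real ^ 'n) \<Rightarrow> (nat \<Rightarrow> 'w \<Rightarrow> real ^ 'n)
     \<Rightarrow> (nat \<Rightarrow> 'w \<Rightarrow> real ^ 'd) \<Rightarrow> (nat \<Rightarrow> 'w \<Rightarrow> real ^ 'd) \<Rightarrow> bool" where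
  "independent_sources P x0 z z' xi xi' \<longleftrightarrow>
     prob_space.indep_sets P
       (\<lambda>i. case i of
              Start \<Rightarrow> generated_events P x0
            | Z t \<Rightarrow> generated_events P (z t)
            | Z' t \<Rightarrow> generated_events P (z' t)
            | Xi t \<Rightarrow> generated_events P (xi t)
            | Xi' t \<Rightarrow> generated_events P (xi' t)) UNIV"

(* V is a sample of the uniform distribution on the cube. It is required to lie in the cube
   everywhere, not just almost surely, because the stochastic mapping may only be evaluated at
   points of the enlarged set. *)
definition uniform_cube_sample :: "'w measure \<Rightarrow> ('w \<Rightarrow> real ^ 'n) \<Rightarrow> real \<Rightarrow> bool" where
  "uniform_cube_sample P V \<epsilon> \<longleftrightarrow>
     V \<in> borel_measurable P \<and> V \<in> space P \<rightarrow> cube \<epsilon> \<and>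
     distr P lborel V = uniform_measure lborel (cube \<epsilon>)"

definition sample_of :: "'w measure \<Rightarrow> ('w \<Rightarrow> real ^ 'd) \<Rightarrow> ('w \<Rightarrow> real ^ 'd) \<Rightarrow> bool" where
  "sample_of P \<xi> V \<longleftrightarrow> V \<in> borel_measurable P \<and> distr P borel V = distr P borel \<xi>"

end

theory Submission
  imports Defs "HOL-Library.Discrete_Functions"
begin

text \<open>
  Sharpness and monotonicity turn the extragradient inequality, averaged over the fresh samples,
  into the recursion \<open>D (t + 1) \<le> (1 - \<alpha> \<gamma> t / M) D t + q (\<gamma> t)\<^sup>2\<close> for
  \<open>D t = E[|x t - x*|\<^sup>2]\<close>. Induction gives \<open>D t \<le> (2 q M / \<alpha>) \<gamma> t\<close>, and the stepsize recursion
  gives \<open>\<gamma> t \<le> 2 M / (\<alpha> t)\<close>. For almost sure convergence it is enough to observe the iterates at the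
  times \<open>k\<^sup>2\<close>: there \<open>D\<close> is summable, and since \<open>E[|x (t + 1) - x t|\<^sup>2] = O(1 / t\<^sup>2)\<close>,
  so is the expected square of the distance travelled between consecutive such times.
\<close>

text \<open>Independence enters only through laws: each query point is built from sources other than
  the sample drawn there, so the pair has a product law and Fubini takes the place of conditional
  expectation. The extragradient inequality leaves a term \<open>-|x - y|^2\<close>, which pays for
  passing from \<open>y\<close> to \<open>x\<close> in the sharpness bound. Monotonicity is applied
  at the perturbed point \<open>y + z\<close>; this costs a multiple of
  \<open>\<gamma> t * eps t\<close>, which is quadratic in the stepsize because
  \<open>eps t = \<beta> * \<gamma> t\<close>. The stepsizes are greedy. Put
  \<open>a t = \<alpha> / (2 * M) * \<gamma> t\<close> and
  \<open>K = 4 * q * M^2 / \<alpha>^2\<close>. If \<open>D t\<close> is at most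
  \<open>K * a t\<close>, a step of normalised size \<open>s\<close>, with \<open>s\<close> at most
  1/2, gives the bound \<open>(1 - 2 * s) * K * a t + K * s^2\<close>. It is smallest at
  \<open>s = a t\<close>, with value \<open>K * a t * (1 - a t)\<close>, so bound and stepsize obey
  the same recursion. The mean-square rate of order \<open>1 / t\<close> is not summable; hence the
  passage to a sparse sequence of times.\<close>

section \<open>Almost sure convergence from mean-square rates\<close>

text \<open>The random series has finite expectation, hence is finite almost surely, and the terms
  of a convergent series vanish.\<close>

lemma (in prob_space) AE_tendsto_0_if_summable_expectation:
  fixes Y :: "nat \<Rightarrow> 'a \<Rightarrow> real"
  assumes int: "\<And>k. integrable M (Y k)"
    and nonneg: "\<And>k \<omega>. Y k \<omega> \<ge> 0"
    and summ: "summable (\<lambda>k. expectation (Y k))"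
  shows "AE \<omega> in M. (\<lambda>k. Y k \<omega>) \<longlonglongrightarrow> 0"
proof -
  have [measurable]: "Y k \<in> borel_measurable M" for k
    using int by (rule borel_measurable_integrable)
  have "(\<integral>\<^sup>+\<omega>. (\<Sum>k. ennreal (Y k \<omega>)) \<partial>M) = (\<Sum>k. \<integral>\<^sup>+\<omega>. ennreal (Y k \<omega>) \<partial>M)"
    by (rule nn_integral_suminf) simp
  also have "\<dots> = (\<Sum>k. ennreal (expectation (Y k)))"
    by (intro suminf_cong nn_integral_eq_integral int) (simp add: nonneg)
  also have "\<dots> = ennreal (\<Sum>k. expectation (Y k))"
    by (intro suminf_ennreal2 summ Bochner_Integration.integral_nonneg nonneg)
  also have "\<dots> < \<infinity>" by simp
  finally have "AE \<omega> in M. (\<Sum>k. ennreal (Y k \<omega>)) \<noteq> \<infinity>"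
    by (intro nn_integral_PInf_AE) auto
  then show ?thesis
  proof eventually_elim
    case (elim \<omega>)
    then have "summable (\<lambda>k. Y k \<omega>)"
      by (intro summable_suminf_not_top nonneg) simp
    then show ?case by (rule summable_LIMSEQ_zero)
  qed
qed

text \<open>Squares are sparse enough for \<open>c / k^2\<close> to be summable and dense enough for
  the gaps: a block has \<open>2 * k + 1\<close> steps, each with expected square at most
  \<open>d / k^4\<close>, so Cauchy-Schwarz bounds the expected squared path length by a multiple of
  \<open>1 / k^2\<close>.\<close>

lemma (in prob_space) AE_tendsto_of_mean_square_rates:
  fixes x :: "nat \<Rightarrow> 'a \<Rightarrow> 'b::euclidean_space"
  assumes dist_int: "\<And>t. integrable M (\<lambda>\<omega>. (norm (x t \<omega> - u))\<^sup>2)"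
    and dist_le: "\<And>t. t \<ge> 1 \<Longrightarrow> expectation (\<lambda>\<omega>. (norm (x t \<omega> - u))\<^sup>2) \<le> c / real t"
    and step_int: "\<And>t. integrable M (\<lambda>\<omega>. (norm (x (Suc t) \<omega> - x t \<omega>))\<^sup>2)"
    and step_le: "\<And>t. t \<ge> 1 \<Longrightarrow>
      expectation (\<lambda>\<omega>. (norm (x (Suc t) \<omega> - x t \<omega>))\<^sup>2) \<le> d / (real t)\<^sup>2"
  shows "AE \<omega> in M. (\<lambda>t. x t \<omega>) \<longlonglongrightarrow> u"
proof -
  let ?B = "\<lambda>k::nat. {k\<^sup>2..<(Suc k)\<^sup>2}"
  \<comment> \<open>The second summand is the Cauchy-Schwarz bound for the squared path length over
    block \<open>k\<close>; the factor is the number of steps in it.\<close>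
  define Y where "Y k \<omega> = (norm (x (k\<^sup>2) \<omega> - u))\<^sup>2
      + (\<Sum>s\<in>?B k. (norm (x (Suc s) \<omega> - x s \<omega>))\<^sup>2) * (2 * real k + 1)" for k \<omega>
  have card_B: "real (card (?B k)) = 2 * real k + 1" for k
    by (simp add: power2_eq_square algebra_simps)
  have Y_int: "integrable M (Y k)" for k
    unfolding Y_def using dist_int step_int by simp
  \<comment> \<open>At \<open>t = 1\<close> a nonnegative expectation is bounded by \<open>d\<close>
    itself.\<close>
  have d0: "d \<ge> 0"
    using order_trans[OF Bochner_Integration.integral_nonneg step_le[of 1]] by simp
  have Y_le: "expectation (Y k) \<le> (c + 9 * d) * inverse ((real k)\<^sup>2)" if "k \<ge> 1" for k
  proof -
    have "expectation (Y k) = expectation (\<lambda>\<omega>. (norm (x (k\<^sup>2) \<omega> - u))\<^sup>2)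
        + (\<Sum>s\<in>?B k. expectation (\<lambda>\<omega>. (norm (x (Suc s) \<omega> - x s \<omega>))\<^sup>2)) * (2 * real k + 1)"
      unfolding Y_def using dist_int step_int by simp
    also have "\<dots> \<le> c / real (k\<^sup>2) + (\<Sum>s\<in>?B k. d / (real k)^4) * (2 * real k + 1)"
    proof (intro add_mono mult_right_mono sum_mono)
      show "expectation (\<lambda>\<omega>. (norm (x (k\<^sup>2) \<omega> - u))\<^sup>2) \<le> c / real (k\<^sup>2)"
        using that by (intro dist_le) simp
    next
      fix s assume "s \<in> ?B k"
      then have s: "k\<^sup>2 \<le> s" by simp
      with one_le_power[OF that, of 2] have s1: "s \<ge> 1" by linarith
      have "(real k)^4 = (real (k\<^sup>2))\<^sup>2" by simp
      also have "\<dots> \<le> (real s)\<^sup>2" by (intro power_mono of_nat_mono s) (rule of_nat_0_le_iff)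
      finally have "d / (real s)\<^sup>2 \<le> d / (real k)^4"
        using d0 that s1 by (intro divide_left_mono) (auto intro!: mult_pos_pos)
      then show "expectation (\<lambda>\<omega>. (norm (x (Suc s) \<omega> - x s \<omega>))\<^sup>2) \<le> d / (real k)^4"
        using step_le[OF s1] by linarith
    qed simp
    also have "(\<Sum>s\<in>?B k. d / (real k)^4) * (2 * real k + 1) = d / (real k)^4 * (2 * real k + 1)\<^sup>2"
      unfolding sum_constant card_B by (simp add: power2_eq_square)
    \<comment> \<open>For \<open>k\<close> at least 1, \<open>2 * k + 1\<close> is at most
      \<open>3 * k\<close>; this is where the 9 comes from.\<close>
    also have "\<dots> \<le> d / (real k)^4 * (3 * real k)\<^sup>2"
      using that d0 by (intro mult_left_mono power_mono) auto
    also have "\<dots> = 9 * d * inverse ((real k)\<^sup>2)"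
      using power_add[of "real k" 2 2] that by (simp add: power_mult_distrib field_simps)
    finally show ?thesis
      by (simp add: distrib_right divide_inverse)
  qed
  have Y_nonneg: "Y k \<omega> \<ge> 0" for k \<omega>
    unfolding Y_def by (intro add_nonneg_nonneg mult_nonneg_nonneg sum_nonneg) auto
  have "summable (\<lambda>k. (c + 9 * d) * inverse ((real k)\<^sup>2))"
    by (intro summable_mult inverse_power_summable) simp
  \<comment> \<open>The rates are assumed from \<open>t = 1\<close> on, so block 0 is left out of
    the comparison.\<close>
  then have "summable (\<lambda>k. expectation (Y k))"
    by (rule summable_comparison_test'[where N = 1])
      (simp add: Y_le Y_nonneg Bochner_Integration.integral_nonneg del: One_nat_def)
  then have "AE \<omega> in M. (\<lambda>k. Y k \<omega>) \<longlonglongrightarrow> 0"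
    by (intro AE_tendsto_0_if_summable_expectation Y_int Y_nonneg)
  then show ?thesis
  proof eventually_elim
    case (elim \<omega>)
    \<comment> \<open>Time \<open>t\<close> lies in block \<open>floor_sqrt t\<close>. The factor 2
      comes from \<open>(r + s)^2 <= 2 * (r^2 + s^2)\<close>, applied to the distance at the start
      of the block and the path length.\<close>
    have bound: "(norm (x t \<omega> - u))\<^sup>2 \<le> 2 * Y (floor_sqrt t) \<omega>" for t
    proof -
      define k where "k = floor_sqrt t"
      let ?S = "\<Sum>s\<in>?B k. norm (x (Suc s) \<omega> - x s \<omega>)"
      have k: "k\<^sup>2 \<le> t" "t < (Suc k)\<^sup>2"
        by (simp_all only: k_def floor_sqrt_power2_le Suc_floor_sqrt_power2_gt)
      have "norm (x t \<omega> - x (k\<^sup>2) \<omega>) = norm (\<Sum>s = k\<^sup>2..<t. x (Suc s) \<omega> - x s \<omega>)"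
        using sum_Suc_diff'[OF k(1), of "\<lambda>s. x s \<omega>"] by simp
      also have "\<dots> \<le> (\<Sum>s = k\<^sup>2..<t. norm (x (Suc s) \<omega> - x s \<omega>))"
        by (rule norm_sum)
      also have "\<dots> \<le> ?S"
        using k by (intro sum_mono2) auto
      finally have "norm (x t \<omega> - u) \<le> norm (x (k\<^sup>2) \<omega> - u) + ?S"
        using norm_triangle_ineq[of "x t \<omega> - x (k\<^sup>2) \<omega>" "x (k\<^sup>2) \<omega> - u"] by simp
      then have "(norm (x t \<omega> - u))\<^sup>2 \<le> (norm (x (k\<^sup>2) \<omega> - u) + ?S)\<^sup>2"
        by (intro power_mono) auto
      also have "\<dots> \<le> 2 * ((norm (x (k\<^sup>2) \<omega> - u))\<^sup>2 + ?S\<^sup>2)"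
        using sum_squares_bound[of "norm (x (k\<^sup>2) \<omega> - u)" ?S] by (simp add: power2_sum)
      also have "?S\<^sup>2 \<le> (\<Sum>s\<in>?B k. (norm (x (Suc s) \<omega> - x s \<omega>))\<^sup>2) * (2 * real k + 1)"
        using sum_squared_le_sum_of_squares[of _ "?B k"] unfolding card_B by simp
      finally show ?thesis by (simp add: Y_def k_def)
    qed
    have "filterlim floor_sqrt at_top sequentially"
      unfolding filterlim_at_top eventually_sequentially by (auto simp: le_floor_sqrt_iff)
    then have lim: "(\<lambda>t. 2 * Y (floor_sqrt t) \<omega>) \<longlonglongrightarrow> 0"
      using filterlim_compose[OF tendsto_mult_right_zero[OF elim]] by blast
    have "(\<lambda>t. (norm (x t \<omega> - u))\<^sup>2) \<longlonglongrightarrow> 0"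
      by (rule tendsto_sandwich[OF _ _ tendsto_const lim]) (simp_all add: bound)
    from tendsto_real_sqrt[OF this] have "(\<lambda>t. norm (x t \<omega> - u)) \<longlonglongrightarrow> 0"
      by simp
    then show ?case
      by (rule LIM_zero_cancel[OF tendsto_norm_zero_cancel])
  qed
qed

section \<open>Deterministic estimates: stepsizes, projections, cubes\<close>

text \<open>The recursion makes \<open>1 / a t\<close> grow by at least \<open>1\<close> in each step.\<close>
lemma logistic_decay:
  fixes a :: "nat \<Rightarrow> real"
  assumes "0 < a 0" "a 0 < 1" and step: "\<And>t. a (Suc t) = a t * (1 - a t)"
  shows "0 < a t" "a t \<le> a 0" "a t \<le> 1 / (real t + 1)"
proof -
  have "0 < a t \<and> a t \<le> a 0 \<and> a t * (real t + 1) \<le> 1"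
  proof (induction t)
    case 0
    then show ?case using assms by simp
  next
    case (Suc t)
    then have a: "0 < a t" "a t < 1" "a t * (real t + 1) \<le> 1" using assms by auto
    \<comment> \<open>The induction hypothesis turns the first factor into \<open>1 + a t\<close>,
      and \<open>(1 + a t) * (1 - a t)\<close> is at most 1.\<close>
    have "a (Suc t) * (real (Suc t) + 1) = (a t * (real t + 1) + a t) * (1 - a t)"
      by (simp add: step algebra_simps)
    also have "\<dots> \<le> (1 + a t) * (1 - a t)"
      using a by (intro mult_right_mono) auto
    also have "\<dots> \<le> 1" by (simp add: algebra_simps)
    finally have "a (Suc t) * (real (Suc t) + 1) \<le> 1" .
    moreover have "a (Suc t) \<le> a t" "0 < a (Suc t)"
      using a by (simp_all add: step mult_left_le)
    ultimately show ?case using Suc by linarith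
  qed
  then show "0 < a t" "a t \<le> a 0" "a t \<le> 1 / (real t + 1)"
    by (auto simp: field_simps)
qed

text \<open>The obtuse-angle property of the projection is used twice: for \<open>x'\<close> against
  \<open>u\<close>, and for \<open>y\<close> against the point \<open>x'\<close> itself. The cross
  terms then collapse to \<open>2 * c * (g' - g) . (x' - y) - |x' - y|^2\<close>, which is at most
  \<open>c^2 * |g' - g|^2\<close>. The term \<open>- (norm (x - y))\<^sup>2\<close> is kept for the
  drift estimate.\<close>

lemma extragradient_step:
  fixes x u g g' :: "'a::euclidean_space"
  assumes X: "closed X" "convex X" and "u \<in> X"
    and y: "y = closest_point X (x - c *\<^sub>R g')" and x': "x' = closest_point X (x - c *\<^sub>R g)"
  shows "(norm (x' - u))\<^sup>2 \<le> (norm (x - u))\<^sup>2 - (norm (x - y))\<^sup>2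
    + 2 * c\<^sup>2 * ((norm g)\<^sup>2 + (norm g')\<^sup>2) + 2 * c * (g \<bullet> (u - y))"
proof -
  have x'X: "x' \<in> X"
    unfolding x' using X \<open>u \<in> X\<close> by (intro closest_point_in_set) auto
  have p1: "(x - c *\<^sub>R g - x') \<bullet> (u - x') \<le> 0"
    unfolding x' using X \<open>u \<in> X\<close> by (intro closest_point_dot)
  have p2: "(x - c *\<^sub>R g' - y) \<bullet> (x' - y) \<le> 0"
    unfolding y using X x'X by (intro closest_point_dot)
  \<comment> \<open>Completes the square in \<open>x' - y\<close>.\<close>
  have p3: "0 \<le> (c *\<^sub>R (g' - g) - (x' - y)) \<bullet> (c *\<^sub>R (g' - g) - (x' - y))" by simp
  \<comment> \<open>The parallelogram law turns this into
    \<open>|g' - g|^2 <= 2 * (|g|^2 + |g'|^2)\<close>, scaled by \<open>c^2\<close>.\<close>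
  have p4: "0 \<le> c * (c * ((g + g') \<bullet> (g + g')))"
    using inner_ge_zero[of "c *\<^sub>R (g + g')"] by simp
  show ?thesis
    using p1 p2 p3 p4 unfolding power2_norm_eq_inner unfolding power2_eq_square
    by (simp add: inner_diff_left inner_diff_right inner_add_left inner_add_right inner_commute
      algebra_simps)
qed

lemma norm_le_of_mem_cube:
  fixes v :: "real ^ 'n"
  assumes "v \<in> cube e"
  shows "norm v \<le> sqrt (real CARD('n)) * e / 2"
proof -
  have b: "\<bar>v $ i\<bar> \<le> e / 2" for i
  proof -
    have "- e / 2 \<le> v $ i" "v $ i \<le> e / 2" using assms by (auto simp: cube_def)
    then show ?thesis by linarith
  qed
  \<comment> \<open>\<open>undefined\<close> stands for an arbitrary coordinate; any one shows that
    \<open>e\<close> is nonnegative.\<close>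
  then have e: "e \<ge> 0" using order_trans[OF abs_ge_zero b[of undefined]] by simp
  have "(\<Sum>i\<in>UNIV. (v $ i)\<^sup>2) \<le> (\<Sum>i\<in>(UNIV::'n set). (e / 2)\<^sup>2)"
    using b by (intro sum_mono) (metis abs_ge_zero power_mono power2_abs)
  then have "norm v \<le> sqrt (real CARD('n) * (e / 2)\<^sup>2)"
    unfolding norm_vec_def L2_set_def by simp
  also have "\<dots> = sqrt (real CARD('n)) * e / 2"
    using e by (simp add: real_sqrt_mult)
  finally show ?thesis .
qed

lemma cube_mono:
  assumes "d \<le> e"
  shows "cube d \<subseteq> cube e"
proof
  fix v :: "real ^ 'n" assume "v \<in> cube d"
  then have "- d / 2 \<le> v $ i" "v $ i \<le> d / 2" for i
    by (auto simp: cube_def)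
  then have "- e / 2 \<le> v $ i" "v $ i \<le> e / 2" for i
    using assms by (meson divide_right_mono neg_le_iff_le order_trans zero_le_numeral)+
  then show "v \<in> cube e" by (simp add: cube_def)
qed

text \<open>A closed set plus a compact box is closed. This makes the enlarged set Borel, which the
  extension of the stochastic mapping by zero requires.\<close>

lemma closed_enlargement:
  fixes X :: "(real ^ 'n) set"
  assumes "closed X"
  shows "closed (enlargement X e)"
proof -
  have "cube e = cbox (\<chi> i. - e / 2) ((\<chi> i. e / 2) :: real ^ 'n)"
    by (auto simp: cube_def mem_box_cart)
  then have "compact (cube e :: (real ^ 'n) set)" by simp
  then have "closed (\<Union>x\<in>X. \<Union>u\<in>cube e. {x + u})"
    by (intro closed_compact_sums assms)
  also have "(\<Union>x\<in>X. \<Union>u\<in>cube e. {x + u}) = enlargement X e"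
    by (auto simp: enlargement_def)
  finally show ?thesis .
qed

section \<open>Product laws and fresh samples\<close>

text \<open>These do the work of conditioning on \<open>U\<close>: under the product law
  \<open>U\<close> is frozen and the sample \<open>V\<close> is averaged out, with
  \<open>\<xi>\<close> on a second copy of the space as its stand-in.\<close>

lemma (in prob_space)
  fixes f :: "'b \<times> 'c \<Rightarrow> real"
  assumes [measurable]: "U \<in> M \<rightarrow>\<^sub>M N" "V \<in> M \<rightarrow>\<^sub>M L"
    and indep: "distr M (N \<Otimes>\<^sub>M L) (\<lambda>\<omega>. (U \<omega>, V \<omega>)) = distr M N U \<Otimes>\<^sub>M distr M L V"
    and same: "distr M L V = distr M L \<xi>"
    and [measurable]: "\<xi> \<in> M \<rightarrow>\<^sub>M L" "f \<in> borel_measurable (N \<Otimes>\<^sub>M L)"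
  shows nn_integral_indep_sample:
      "(\<integral>\<^sup>+\<omega>. f (U \<omega>, V \<omega>) \<partial>M) = (\<integral>\<^sup>+\<omega>. \<integral>\<^sup>+\<omega>'. f (U \<omega>, \<xi> \<omega>') \<partial>M \<partial>M)"
    and integral_indep_sample: "integrable M (\<lambda>\<omega>. f (U \<omega>, V \<omega>)) \<Longrightarrow>
      (\<integral>\<omega>. f (U \<omega>, V \<omega>) \<partial>M) = (\<integral>\<omega>. \<integral>\<omega>'. f (U \<omega>, \<xi> \<omega>') \<partial>M \<partial>M)"
    and integrable_indep_sample: "integrable M (\<lambda>\<omega>. f (U \<omega>, V \<omega>)) \<Longrightarrow>
      integrable M (\<lambda>\<omega>. \<integral>\<omega>'. f (U \<omega>, \<xi> \<omega>') \<partial>M)"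
proof -
  interpret U: prob_space "distr M N U" by (rule prob_space_distr) simp
  interpret V: prob_space "distr M L \<xi>" by (rule prob_space_distr) simp
  interpret UV: pair_prob_space "distr M N U" "distr M L \<xi>" ..
  have joint: "distr M (N \<Otimes>\<^sub>M L) (\<lambda>\<omega>. (U \<omega>, V \<omega>)) = distr M N U \<Otimes>\<^sub>M distr M L \<xi>"
    using indep same by simp
  have "(\<integral>\<^sup>+\<omega>. f (U \<omega>, V \<omega>) \<partial>M) = (\<integral>\<^sup>+p. f p \<partial>(distr M N U \<Otimes>\<^sub>M distr M L \<xi>))"
    unfolding joint[symmetric] by (subst nn_integral_distr) auto
  also have "\<dots> = (\<integral>\<^sup>+u. \<integral>\<^sup>+v. f (u, v) \<partial>distr M L \<xi> \<partial>distr M N U)"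
    by (subst V.nn_integral_fst) auto
  also have "\<dots> = (\<integral>\<^sup>+\<omega>. \<integral>\<^sup>+v. f (U \<omega>, v) \<partial>distr M L \<xi> \<partial>M)"
    by (subst nn_integral_distr) auto
  also have "\<dots> = (\<integral>\<^sup>+\<omega>. \<integral>\<^sup>+\<omega>'. f (U \<omega>, \<xi> \<omega>') \<partial>M \<partial>M)"
    by (intro nn_integral_cong, subst nn_integral_distr) auto
  finally show "(\<integral>\<^sup>+\<omega>. f (U \<omega>, V \<omega>) \<partial>M) = (\<integral>\<^sup>+\<omega>. \<integral>\<^sup>+\<omega>'. f (U \<omega>, \<xi> \<omega>') \<partial>M \<partial>M)" .
  {
    assume int: "integrable M (\<lambda>\<omega>. f (U \<omega>, V \<omega>))"
    have int': "integrable (distr M N U \<Otimes>\<^sub>M distr M L \<xi>) f"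
      unfolding joint[symmetric] using int by (subst integrable_distr_eq) auto
    have inner: "(\<integral>v. f (u, v) \<partial>distr M L \<xi>) = (\<integral>\<omega>'. f (u, \<xi> \<omega>') \<partial>M)" if "u \<in> space N" for u
      using that by (subst integral_distr) auto
    have "integrable (distr M N U) (\<lambda>u. \<integral>v. f (u, v) \<partial>distr M L \<xi>)"
      by (rule UV.integrable_fst'[OF int'])
    then have "integrable M (\<lambda>\<omega>. \<integral>v. f (U \<omega>, v) \<partial>distr M L \<xi>)"
      by (subst (asm) integrable_distr_eq) auto
    then show "integrable M (\<lambda>\<omega>. \<integral>\<omega>'. f (U \<omega>, \<xi> \<omega>') \<partial>M)"
      by (rule Bochner_Integration.integrable_cong[THEN iffD1, rotated 2])
        (auto simp: inner measurable_space[of U M N])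
    have "(\<integral>\<omega>. f (U \<omega>, V \<omega>) \<partial>M) = (\<integral>p. f p \<partial>(distr M N U \<Otimes>\<^sub>M distr M L \<xi>))"
      unfolding joint[symmetric] by (subst integral_distr) auto
    also have "\<dots> = (\<integral>u. \<integral>v. f (u, v) \<partial>distr M L \<xi> \<partial>distr M N U)"
      by (rule UV.integral_fst'[symmetric, OF int'])
    also have "\<dots> = (\<integral>\<omega>. \<integral>v. f (U \<omega>, v) \<partial>distr M L \<xi> \<partial>M)"
      by (subst integral_distr) auto
    also have "\<dots> = (\<integral>\<omega>. \<integral>\<omega>'. f (U \<omega>, \<xi> \<omega>') \<partial>M \<partial>M)"
      by (intro Bochner_Integration.integral_cong refl inner) (auto intro: measurable_space[of U M N])
    finally show "(\<integral>\<omega>. f (U \<omega>, V \<omega>) \<partial>M) = (\<integral>\<omega>. \<integral>\<omega>'. f (U \<omega>, \<xi> \<omega>') \<partial>M \<partial>M)" .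
  }
qed

text \<open>Independence passes from the single sources to the sigma-algebras of disjoint groups of
  them. So \<open>V\<close> may be any measurable function of the sources in \<open>I\<close>, such
  as an iterate, and the product law is checked on rectangles.\<close>

lemma (in prob_space)
  assumes indep: "indep_sets G UNIV" and Int_stable: "\<And>i. Int_stable (G i)"
    and V: "V \<in> sigma (space M) (\<Union>i\<in>I. G i) \<rightarrow>\<^sub>M N"
    and W: "W \<in> sigma (space M) (G j) \<rightarrow>\<^sub>M L" and "j \<notin> I"
  shows random_variable_of_indep_sigma_algebras: "random_variable N V" "random_variable L W"
    and distr_pair_of_indep_sigma_algebras:
      "distr M (N \<Otimes>\<^sub>M L) (\<lambda>\<omega>. (V \<omega>, W \<omega>)) = distr M N V \<Otimes>\<^sub>M distr M L W"
proof -
  have ev: "G i \<subseteq> events" for i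
    using indep by (simp add: indep_sets_def)
  then have Pow: "G i \<subseteq> Pow (space M)" for i
    using sets.space_closed by blast
  \<comment> \<open>A boolean index tells the two groups \<open>I\<close> and \<open>{j}\<close>
    apart.\<close>
  have "indep_sets (\<lambda>b. sigma_sets (space M) (\<Union>i\<in>(if b then I else {j}). G i)) UNIV"
    by (rule indep_sets_collect_sigma)
      (auto intro: indep_sets_mono_index[OF _ indep] Int_stable simp: disjoint_family_on_def \<open>j \<notin> I\<close>)
  moreover have "(\<lambda>b. sigma_sets (space M) (\<Union>i\<in>(if b then I else {j}). G i))
      = case_bool (sigma_sets (space M) (\<Union>i\<in>I. G i)) (sigma_sets (space M) (G j))"
    by (rule ext) (auto split: bool.split)
  ultimately have ind: "indep_set (sigma_sets (space M) (\<Union>i\<in>I. G i)) (sigma_sets (space M) (G j))"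
    by (simp add: indep_set_def)
  have sub: "subalgebra M (sigma (space M) A)" if "A \<subseteq> events" for A
    using that sets.sigma_sets_subset[OF that] sets.space_closed[of M]
    by (auto simp: subalgebra_def sets_measure_of space_measure_of_conv)
  show [measurable]: "random_variable N V" "random_variable L W"
    using measurable_from_subalg[OF sub V] measurable_from_subalg[OF sub W] ev by auto
  interpret V: prob_space "distr M N V" by (rule prob_space_distr) simp
  interpret W: prob_space "distr M L W" by (rule prob_space_distr) simp
  have "distr M N V \<Otimes>\<^sub>M distr M L W = distr M (N \<Otimes>\<^sub>M L) (\<lambda>\<omega>. (V \<omega>, W \<omega>))"
  proof (rule pair_measure_eqI)
    fix A B assume "A \<in> sets (distr M N V)" "B \<in> sets (distr M L W)"
    then have [measurable]: "A \<in> sets N" "B \<in> sets L" by auto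
    have "V -` A \<inter> space M \<in> sigma_sets (space M) (\<Union>i\<in>I. G i)"
      using measurable_sets[OF V \<open>A \<in> sets N\<close>] Pow
      by (simp add: space_measure_of_conv sets_measure_of UN_least)
    moreover have "W -` B \<inter> space M \<in> sigma_sets (space M) (G j)"
      using measurable_sets[OF W \<open>B \<in> sets L\<close>] Pow
      by (simp add: space_measure_of_conv sets_measure_of)
    ultimately have "prob ((V -` A \<inter> space M) \<inter> (W -` B \<inter> space M))
        = prob (V -` A \<inter> space M) * prob (W -` B \<inter> space M)"
      using ind unfolding indep_sets2_eq by blast
    moreover have "(\<lambda>\<omega>. (V \<omega>, W \<omega>)) -` (A \<times> B) \<inter> space M
        = (V -` A \<inter> space M) \<inter> (W -` B \<inter> space M)"
      by auto
    ultimately show "emeasure (distr M N V) A * emeasure (distr M L W) B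
        = emeasure (distr M (N \<Otimes>\<^sub>M L) (\<lambda>\<omega>. (V \<omega>, W \<omega>))) (A \<times> B)"
      by (simp add: emeasure_distr emeasure_eq_measure flip: ennreal_mult)
  qed (auto intro: V.sigma_finite_measure_axioms W.sigma_finite_measure_axioms)
  then show "distr M (N \<Otimes>\<^sub>M L) (\<lambda>\<omega>. (V \<omega>, W \<omega>)) = distr M N V \<Otimes>\<^sub>M distr M L W" ..
qed

section \<open>Drift of the exact mapping\<close>

text \<open>Monotonicity between \<open>y + z\<close> and \<open>u\<close> moves \<open>F\<close> to
  the solution, where sharpness applies; the two inner products with \<open>z\<close> cost
  \<open>C * r\<close> each. This yields decrease linear in \<open>norm (y - u)\<close>, which still
  has to be expressed through \<open>x\<close> and made quadratic.\<close>

lemma sharp_monotone_drift: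
  fixes F :: "'a::real_inner \<Rightarrow> 'a"
  assumes mono: "monotone_map_on E F" and bounded: "\<And>v. v \<in> E \<Longrightarrow> norm (F v) \<le> C"
    and "u \<in> E" "y + z \<in> E" and sharp: "\<alpha> * norm (y - u) \<le> F u \<bullet> (y - u)"
    and "0 \<le> \<alpha>" "\<alpha> \<le> C" "0 \<le> c" "norm z \<le> r"
    and "0 < M" "norm x \<le> M" "norm u \<le> M"
  shows "(norm (x - u))\<^sup>2 - (norm (x - y))\<^sup>2 + 2 * c * (F (y + z) \<bullet> (u - y))
    \<le> (1 - \<alpha> * c / M) * (norm (x - u))\<^sup>2 + (c\<^sup>2 * C\<^sup>2 + 4 * c * C * r)"
proof -
  have "0 \<le> (F (y + z) - F u) \<bullet> (y + z - u)"
    using mono \<open>u \<in> E\<close> \<open>y + z \<in> E\<close> unfolding monotone_map_on_def by blast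
  moreover have "\<bar>F v \<bullet> z\<bar> \<le> C * r" if "v \<in> E" for v
  proof -
    have "\<bar>F v \<bullet> z\<bar> \<le> norm (F v) * norm z" by (rule Cauchy_Schwarz_ineq2)
    also have "\<dots> \<le> C * r"
      using bounded[OF that] \<open>norm z \<le> r\<close> \<open>0 \<le> \<alpha>\<close> \<open>\<alpha> \<le> C\<close> by (intro mult_mono) auto
    finally show ?thesis .
  qed
  from this[OF \<open>u \<in> E\<close>] this[OF \<open>y + z \<in> E\<close>]
  have "- (F u \<bullet> z) \<le> C * r" "F (y + z) \<bullet> z \<le> C * r" by auto
  ultimately have "F (y + z) \<bullet> (u - y) \<le> 2 * (C * r) - F u \<bullet> (y - u)"
    by (simp add: inner_diff_left inner_diff_right inner_add_right)
  also have "\<dots> \<le> 2 * (C * r) - \<alpha> * norm (y - u)"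
    using sharp by simp
  also have "\<dots> \<le> 2 * (C * r) - \<alpha> * (norm (x - u) - norm (x - y))"
    using norm_triangle_ineq[of "x - y" "y - u"] \<open>0 \<le> \<alpha>\<close>
    by (intro diff_left_mono mult_left_mono) auto
  finally have "2 * c * (F (y + z) \<bullet> (u - y))
      \<le> 2 * c * (2 * (C * r) - \<alpha> * (norm (x - u) - norm (x - y)))"
    using \<open>0 \<le> c\<close> by (intro mult_left_mono) auto
  also have "\<dots> = 4 * c * C * r - 2 * c * \<alpha> * norm (x - u) + 2 * (c * \<alpha>) * norm (x - y)"
    by (simp add: algebra_simps)
  \<comment> \<open>The price of replacing \<open>y\<close> by \<open>x\<close>: its square part
    cancels the negative term kept by the extragradient inequality.\<close>
  also have "2 * (c * \<alpha>) * norm (x - y) \<le> (c * \<alpha>)\<^sup>2 + (norm (x - y))\<^sup>2"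
    by (rule sum_squares_bound)
  also have "(c * \<alpha>)\<^sup>2 \<le> c\<^sup>2 * C\<^sup>2"
    using \<open>0 \<le> \<alpha>\<close> \<open>\<alpha> \<le> C\<close> by (simp add: power_mult_distrib mult_left_mono power_mono)
  \<comment> \<open>Boundedness upgrades linear decrease to a contraction: a distance of at most
    \<open>2 * M\<close> dominates its own square divided by \<open>2 * M\<close>.\<close>
  also have "\<alpha> * c / M * (norm (x - u))\<^sup>2 \<le> 2 * c * \<alpha> * norm (x - u)"
  proof -
    have "norm (x - u) \<le> 2 * M"
      using norm_triangle_ineq4[of x u] assms by linarith
    then have "\<alpha> * c / M * norm (x - u) * norm (x - u) \<le> \<alpha> * c / M * norm (x - u) * (2 * M)"
      using assms by (intro mult_left_mono) auto
    also have "\<dots> = 2 * c * \<alpha> * norm (x - u)"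
      using \<open>0 < M\<close> by simp
    finally show ?thesis by (simp add: power2_eq_square mult.assoc)
  qed
  ultimately show ?thesis by (simp add: algebra_simps)
qed

section \<open>Random queries of the stochastic mapping\<close>

text \<open>Measurability is global while mean and second moment are controlled only on
  \<open>E\<close>; this fits a mapping extended by zero outside \<open>E\<close>.\<close>

locale stochastic_mapping = prob_space +
  fixes \<xi> :: "'a \<Rightarrow> 'c::euclidean_space" and \<Psi> :: "'b::euclidean_space \<Rightarrow> 'c \<Rightarrow> 'b"
    and E :: "'b set" and F :: "'b \<Rightarrow> 'b" and B :: real
  assumes xi_measurable [measurable]: "\<xi> \<in> borel_measurable M"
    and mapping_measurable [measurable]: "(\<lambda>(u, s). \<Psi> u s) \<in> borel_measurable (borel \<Otimes>\<^sub>M borel)"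
    and mapping_mean: "u \<in> E \<Longrightarrow> has_bochner_integral M (\<lambda>\<omega>. \<Psi> u (\<xi> \<omega>)) (F u)"
    and mapping_square: "u \<in> E \<Longrightarrow> integrable M (\<lambda>\<omega>. (norm (\<Psi> u (\<xi> \<omega>)))\<^sup>2)"
      "u \<in> E \<Longrightarrow> expectation (\<lambda>\<omega>. (norm (\<Psi> u (\<xi> \<omega>)))\<^sup>2) \<le> B"
begin

text \<open>\<open>R\<close> holds all randomness present when the query is made and
  \<open>p\<close> reads the query point off it. They are kept apart because the test vector
  \<open>T\<close> below also depends on \<open>R\<close>, not only on the query point.\<close>

context
  fixes N :: "'r measure" and R :: "'a \<Rightarrow> 'r" and p :: "'r \<Rightarrow> 'b" and V :: "'a \<Rightarrow> 'c"
  assumes R [measurable]: "R \<in> M \<rightarrow>\<^sub>M N" and V [measurable]: "V \<in> borel_measurable M"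
    and same: "distr M borel V = distr M borel \<xi>"
    and joint: "distr M (N \<Otimes>\<^sub>M borel) (\<lambda>\<omega>. (R \<omega>, V \<omega>)) = distr M N R \<Otimes>\<^sub>M distr M borel V"
    and p [measurable]: "p \<in> borel_measurable N" and p_mem: "p \<in> R ` space M \<rightarrow> E"
begin

lemma random_query_measurable [measurable]: "(\<lambda>\<omega>. \<Psi> (p (R \<omega>)) (V \<omega>)) \<in> borel_measurable M"
  by measurable

text \<open>With \<open>R\<close> frozen the inner second moment is at most \<open>B\<close> at
  every point. The integrand being nonnegative, Tonelli gives integrability and bound
  together.\<close>

lemma random_query_square:
  shows "integrable M (\<lambda>\<omega>. (norm (\<Psi> (p (R \<omega>)) (V \<omega>)))\<^sup>2)" (is ?int)
    and "expectation (\<lambda>\<omega>. (norm (\<Psi> (p (R \<omega>)) (V \<omega>)))\<^sup>2) \<le> B" (is ?le)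
proof -
  let ?f = "\<lambda>(r, s). (norm (\<Psi> (p r) s))\<^sup>2"
  have mem: "p (R \<omega>) \<in> E" if "\<omega> \<in> space M" for \<omega>
    using p_mem that by auto
  \<comment> \<open>A probability space has a point, so some query lies in \<open>E\<close> and its
    second moment forces \<open>B\<close> to be nonnegative.\<close>
  have B: "0 \<le> B"
  proof -
    obtain \<omega> where "\<omega> \<in> space M" using not_empty by blast
    then show ?thesis
      using order_trans[OF Bochner_Integration.integral_nonneg mapping_square(2)[OF mem]] by simp
  qed
  have "(\<integral>\<^sup>+\<omega>. ennreal (?f (R \<omega>, V \<omega>)) \<partial>M) = (\<integral>\<^sup>+\<omega>. \<integral>\<^sup>+\<omega>'. ?f (R \<omega>, \<xi> \<omega>') \<partial>M \<partial>M)"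
    by (rule nn_integral_indep_sample[OF R V joint same]) measurable
  also have "\<dots> \<le> (\<integral>\<^sup>+\<omega>. ennreal B \<partial>M)"
  proof (rule nn_integral_mono)
    fix \<omega> assume "\<omega> \<in> space M"
    note E = mem[OF this]
    have "(\<integral>\<^sup>+\<omega>'. ?f (R \<omega>, \<xi> \<omega>') \<partial>M) = ennreal (expectation (\<lambda>\<omega>'. (norm (\<Psi> (p (R \<omega>)) (\<xi> \<omega>')))\<^sup>2))"
      unfolding prod.case by (intro nn_integral_eq_integral mapping_square(1)[OF E]) simp
    also have "\<dots> \<le> ennreal B"
      by (intro ennreal_leI mapping_square(2)[OF E])
    finally show "(\<integral>\<^sup>+\<omega>'. ?f (R \<omega>, \<xi> \<omega>') \<partial>M) \<le> ennreal B" .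
  qed
  also have "\<dots> = ennreal B" by (simp add: emeasure_space_1)
  finally have le: "(\<integral>\<^sup>+\<omega>. ennreal ((norm (\<Psi> (p (R \<omega>)) (V \<omega>)))\<^sup>2) \<partial>M) \<le> ennreal B" by simp
  show ?int
  proof (rule integrableI_bounded)
    show "(\<integral>\<^sup>+\<omega>. ennreal (norm ((norm (\<Psi> (p (R \<omega>)) (V \<omega>)))\<^sup>2)) \<partial>M) < \<infinity>"
      using le_less_trans[OF le, of \<infinity>] by simp
  qed measurable
  then have "ennreal (expectation (\<lambda>\<omega>. (norm (\<Psi> (p (R \<omega>)) (V \<omega>)))\<^sup>2)) \<le> ennreal B"
    using le by (subst nn_integral_eq_integral[symmetric]) auto
  then show ?le using B by simp
qed

text \<open>With \<open>R\<close> frozen both \<open>p\<close> and \<open>T\<close> are constants,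
  so the inner integral is that of an unbiased sample. \<open>F\<close> carries no measurability
  assumption; the integrability of its product with \<open>T\<close> is inherited from
  Fubini.\<close>

lemma random_query_inner:
  assumes [measurable]: "T \<in> borel_measurable N" and T_le: "\<And>\<omega>. \<omega> \<in> space M \<Longrightarrow> norm (T (R \<omega>)) \<le> K"
  shows "integrable M (\<lambda>\<omega>. \<Psi> (p (R \<omega>)) (V \<omega>) \<bullet> T (R \<omega>))" (is ?int)
    and "integrable M (\<lambda>\<omega>. F (p (R \<omega>)) \<bullet> T (R \<omega>))" (is ?int')
    and "expectation (\<lambda>\<omega>. \<Psi> (p (R \<omega>)) (V \<omega>) \<bullet> T (R \<omega>)) = expectation (\<lambda>\<omega>. F (p (R \<omega>)) \<bullet> T (R \<omega>))"
      (is ?eq)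
proof -
  let ?f = "\<lambda>(r, s). \<Psi> (p r) s \<bullet> T r"
  have f [measurable]: "?f \<in> borel_measurable (N \<Otimes>\<^sub>M borel)" by measurable
  show int: ?int
  proof (rule Bochner_Integration.integrable_bound)
    show "integrable M (\<lambda>\<omega>. (norm (\<Psi> (p (R \<omega>)) (V \<omega>)))\<^sup>2 + K\<^sup>2)"
      using random_query_square(1) by simp
    show "AE \<omega> in M. norm (\<Psi> (p (R \<omega>)) (V \<omega>) \<bullet> T (R \<omega>)) \<le> norm ((norm (\<Psi> (p (R \<omega>)) (V \<omega>)))\<^sup>2 + K\<^sup>2)"
    proof (rule AE_I2)
      fix \<omega> assume "\<omega> \<in> space M"
      let ?a = "norm (\<Psi> (p (R \<omega>)) (V \<omega>))"
      have "norm (\<Psi> (p (R \<omega>)) (V \<omega>) \<bullet> T (R \<omega>)) \<le> ?a * norm (T (R \<omega>))"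
        by (simp add: Cauchy_Schwarz_ineq2)
      also have "\<dots> \<le> ?a * K"
        by (intro mult_left_mono T_le \<open>\<omega> \<in> space M\<close>) simp
      \<comment> \<open>A square-integrable dominating function, from the arithmetic-geometric mean
        inequality.\<close>
      also have "\<dots> \<le> ?a\<^sup>2 + K\<^sup>2"
        using sum_squares_bound[of ?a K] zero_le_power2[of ?a] zero_le_power2[of K] by linarith
      finally show "norm (\<Psi> (p (R \<omega>)) (V \<omega>) \<bullet> T (R \<omega>)) \<le> norm (?a\<^sup>2 + K\<^sup>2)" by simp
    qed
  qed measurable
  have inner: "(\<integral>\<omega>'. ?f (R \<omega>, \<xi> \<omega>') \<partial>M) = F (p (R \<omega>)) \<bullet> T (R \<omega>)" if "\<omega> \<in> space M" for \<omega>
  proof -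
    have "p (R \<omega>) \<in> E" using p_mem that by auto
    from mapping_mean[OF this] show ?thesis
      by (simp add: has_bochner_integral_iff)
  qed
  note indep = R V joint same xi_measurable f
  have "integrable M (\<lambda>\<omega>. \<integral>\<omega>'. ?f (R \<omega>, \<xi> \<omega>') \<partial>M)"
    using integrable_indep_sample[OF indep] int by simp
  then show ?int'
    by (rule Bochner_Integration.integrable_cong[THEN iffD1, rotated 2]) (simp_all only: inner)
  have "expectation (\<lambda>\<omega>. \<Psi> (p (R \<omega>)) (V \<omega>) \<bullet> T (R \<omega>)) = (\<integral>\<omega>. \<integral>\<omega>'. ?f (R \<omega>, \<xi> \<omega>') \<partial>M \<partial>M)"
    using integral_indep_sample[OF indep] int by simp
  also have "\<dots> = expectation (\<lambda>\<omega>. F (p (R \<omega>)) \<bullet> T (R \<omega>))"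
    by (rule Bochner_Integration.integral_cong) (simp_all only: inner)
  finally show ?eq .
qed

end

text \<open>In expectation the sample at \<open>y + z\<close> may be exchanged for \<open>F\<close>
  in the inner product, after which the drift applies pointwise; the sample at \<open>x + z'\<close>
  enters only by its second moment. The two second moments give
  \<open>2 * c\<^sup>2 * (B + B)\<close>.\<close>

lemma expected_extragradient_step:
  fixes x y x' z z' :: "'a \<Rightarrow> 'b" and v v' :: "'a \<Rightarrow> 'c"
  assumes X: "closed X" "convex X" "u \<in> X" and bounded: "\<And>a. a \<in> X \<Longrightarrow> norm a \<le> K"
    and meas [measurable]: "x \<in> borel_measurable M" "y \<in> borel_measurable M" "x' \<in> borel_measurable M"
      "z \<in> borel_measurable M" "z' \<in> borel_measurable M"
      "v \<in> borel_measurable M" "v' \<in> borel_measurable M"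
    and same: "distr M borel v = distr M borel \<xi>" "distr M borel v' = distr M borel \<xi>"
    and joint: "distr M ((borel \<Otimes>\<^sub>M borel) \<Otimes>\<^sub>M borel) (\<lambda>\<omega>. ((y \<omega>, z \<omega>), v \<omega>))
        = distr M (borel \<Otimes>\<^sub>M borel) (\<lambda>\<omega>. (y \<omega>, z \<omega>)) \<Otimes>\<^sub>M distr M borel v"
    and joint': "distr M ((borel \<Otimes>\<^sub>M borel) \<Otimes>\<^sub>M borel) (\<lambda>\<omega>. ((x \<omega>, z' \<omega>), v' \<omega>))
        = distr M (borel \<Otimes>\<^sub>M borel) (\<lambda>\<omega>. (x \<omega>, z' \<omega>)) \<Otimes>\<^sub>M distr M borel v'"
    and mem: "\<And>\<omega>. \<omega> \<in> space M \<Longrightarrow> x \<omega> \<in> X"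
      "\<And>\<omega>. \<omega> \<in> space M \<Longrightarrow> x \<omega> + z' \<omega> \<in> E" "\<And>\<omega>. \<omega> \<in> space M \<Longrightarrow> y \<omega> + z \<omega> \<in> E"
    and y: "\<And>\<omega>. \<omega> \<in> space M \<Longrightarrow> y \<omega> = closest_point X (x \<omega> - c *\<^sub>R \<Psi> (x \<omega> + z' \<omega>) (v' \<omega>))"
    and x': "\<And>\<omega>. \<omega> \<in> space M \<Longrightarrow> x' \<omega> = closest_point X (x \<omega> - c *\<^sub>R \<Psi> (y \<omega> + z \<omega>) (v \<omega>))"
    and drift: "\<And>\<omega>. \<omega> \<in> space M \<Longrightarrow>
      (norm (x \<omega> - u))\<^sup>2 - (norm (x \<omega> - y \<omega>))\<^sup>2 + 2 * c * (F (y \<omega> + z \<omega>) \<bullet> (u - y \<omega>))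
        \<le> \<rho> * (norm (x \<omega> - u))\<^sup>2 + \<delta>"
  shows "expectation (\<lambda>\<omega>. (norm (x' \<omega> - u))\<^sup>2)
      \<le> \<rho> * expectation (\<lambda>\<omega>. (norm (x \<omega> - u))\<^sup>2) + \<delta> + 4 * c\<^sup>2 * B" (is ?le)
    and "integrable M (\<lambda>\<omega>. (norm (x' \<omega> - x \<omega>))\<^sup>2)" (is ?int)
    and "expectation (\<lambda>\<omega>. (norm (x' \<omega> - x \<omega>))\<^sup>2) \<le> c\<^sup>2 * B" (is ?step)
proof -
  define g where "g \<omega> = \<Psi> (y \<omega> + z \<omega>) (v \<omega>)" for \<omega>
  define g' where "g' \<omega> = \<Psi> (x \<omega> + z' \<omega>) (v' \<omega>)" for \<omega>
  have mem': "y \<omega> \<in> X" "x' \<omega> \<in> X" if "\<omega> \<in> space M" for \<omega>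
    using X that by (auto simp: x' y intro!: closest_point_in_set)
  have sq_int: "integrable M (\<lambda>\<omega>. (norm (a \<omega> - b \<omega>))\<^sup>2)"
    if [measurable]: "a \<in> borel_measurable M" "b \<in> borel_measurable M"
      and ab: "\<And>\<omega>. \<omega> \<in> space M \<Longrightarrow> a \<omega> \<in> X" "\<And>\<omega>. \<omega> \<in> space M \<Longrightarrow> b \<omega> \<in> X" for a b
  proof (rule integrable_const_bound)
    show "AE \<omega> in M. norm ((norm (a \<omega> - b \<omega>))\<^sup>2) \<le> (2 * K)\<^sup>2"
    proof (rule AE_I2)
      fix \<omega> assume "\<omega> \<in> space M"
      then have "norm (a \<omega> - b \<omega>) \<le> 2 * K"
        using norm_triangle_ineq4[of "a \<omega>" "b \<omega>"] bounded[OF ab(1)] bounded[OF ab(2)] by fastforce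
      then have "(norm (a \<omega> - b \<omega>))\<^sup>2 \<le> (2 * K)\<^sup>2" by (rule power_mono) simp
      then show "norm ((norm (a \<omega> - b \<omega>))\<^sup>2) \<le> (2 * K)\<^sup>2" by simp
    qed
  qed measurable
  note int = sq_int[OF meas(1) borel_measurable_const mem(1) X(3)]
    sq_int[OF meas(3) borel_measurable_const mem'(2) X(3)] sq_int[OF meas(1,2) mem(1) mem'(1)]
    sq_int[OF meas(3,1) mem'(2) mem(1)]
  let ?add = "\<lambda>(a, b). a + b :: 'b"
  have pair [measurable]: "(\<lambda>\<omega>. (y \<omega>, z \<omega>)) \<in> M \<rightarrow>\<^sub>M borel \<Otimes>\<^sub>M borel"
      "(\<lambda>\<omega>. (x \<omega>, z' \<omega>)) \<in> M \<rightarrow>\<^sub>M borel \<Otimes>\<^sub>M borel"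
      "?add \<in> borel_measurable (borel \<Otimes>\<^sub>M borel)"
    by measurable
  have add_mem: "?add \<in> (\<lambda>\<omega>. (y \<omega>, z \<omega>)) ` space M \<rightarrow> E" "?add \<in> (\<lambda>\<omega>. (x \<omega>, z' \<omega>)) ` space M \<rightarrow> E"
    using mem by auto
  note query = pair(1) meas(6) same(1) joint pair(3) add_mem(1)
  note query' = pair(2) meas(7) same(2) joint' pair(3) add_mem(2)
  have g_sq: "integrable M (\<lambda>\<omega>. (norm (g \<omega>))\<^sup>2)" "expectation (\<lambda>\<omega>. (norm (g \<omega>))\<^sup>2) \<le> B"
    using random_query_square[OF query] by (simp_all add: g_def)
  have g'_sq: "integrable M (\<lambda>\<omega>. (norm (g' \<omega>))\<^sup>2)" "expectation (\<lambda>\<omega>. (norm (g' \<omega>))\<^sup>2) \<le> B"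
    using random_query_square[OF query'] by (simp_all add: g'_def)
  have T_le: "norm (u - y \<omega>) \<le> 2 * K" if "\<omega> \<in> space M" for \<omega>
    using norm_triangle_ineq4[of u "y \<omega>"] bounded[OF X(3)] bounded[OF mem'(1)[OF that]] by linarith
  have g_inner: "integrable M (\<lambda>\<omega>. g \<omega> \<bullet> (u - y \<omega>))"
      "integrable M (\<lambda>\<omega>. F (y \<omega> + z \<omega>) \<bullet> (u - y \<omega>))"
      "expectation (\<lambda>\<omega>. g \<omega> \<bullet> (u - y \<omega>)) = expectation (\<lambda>\<omega>. F (y \<omega> + z \<omega>) \<bullet> (u - y \<omega>))"
    \<comment> \<open>The test vector \<open>u - y\<close> is a function of the pair
      \<open>(y, z)\<close> and is bounded because \<open>X\<close> is.\<close>
    using random_query_inner[OF query, of "\<lambda>(a, b). u - a" "2 * K"] T_le by (simp_all add: g_def)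
  have "expectation (\<lambda>\<omega>. (norm (x' \<omega> - u))\<^sup>2)
      \<le> expectation (\<lambda>\<omega>. (norm (x \<omega> - u))\<^sup>2 - (norm (x \<omega> - y \<omega>))\<^sup>2
        + 2 * c\<^sup>2 * ((norm (g \<omega>))\<^sup>2 + (norm (g' \<omega>))\<^sup>2) + 2 * c * (g \<omega> \<bullet> (u - y \<omega>)))"
    using int g_sq g'_sq g_inner X
    by (intro integral_mono) (auto intro!: extragradient_step[of X] simp: x' y g_def g'_def)
  also have "\<dots> = expectation (\<lambda>\<omega>. (norm (x \<omega> - u))\<^sup>2 - (norm (x \<omega> - y \<omega>))\<^sup>2
        + 2 * c * (F (y \<omega> + z \<omega>) \<bullet> (u - y \<omega>)))
      + 2 * c\<^sup>2 * (expectation (\<lambda>\<omega>. (norm (g \<omega>))\<^sup>2) + expectation (\<lambda>\<omega>. (norm (g' \<omega>))\<^sup>2))"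
    using int g_sq g'_sq g_inner by simp
  also have "\<dots>
      \<le> expectation (\<lambda>\<omega>. \<rho> * (norm (x \<omega> - u))\<^sup>2 + \<delta>) + 2 * c\<^sup>2 * (B + B)"
  proof (rule add_mono)
    show "expectation (\<lambda>\<omega>. (norm (x \<omega> - u))\<^sup>2 - (norm (x \<omega> - y \<omega>))\<^sup>2
        + 2 * c * (F (y \<omega> + z \<omega>) \<bullet> (u - y \<omega>))) \<le> expectation (\<lambda>\<omega>. \<rho> * (norm (x \<omega> - u))\<^sup>2 + \<delta>)"
      using int g_inner by (intro integral_mono drift) auto
  qed (intro mult_left_mono add_mono g_sq g'_sq, simp)
  also have "\<dots> = \<rho> * expectation (\<lambda>\<omega>. (norm (x \<omega> - u))\<^sup>2) + \<delta> + 4 * c\<^sup>2 * B"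
    using int by (simp add: prob_space)
  finally show ?le .
  show ?int by (rule int)
  have "expectation (\<lambda>\<omega>. (norm (x' \<omega> - x \<omega>))\<^sup>2) \<le> expectation (\<lambda>\<omega>. c\<^sup>2 * (norm (g \<omega>))\<^sup>2)"
  proof (rule integral_mono)
    fix \<omega> assume \<omega>: "\<omega> \<in> space M"
    \<comment> \<open>Projection is nonexpansive and fixes \<open>x\<close>, so the move is no
      longer than the unprojected step.\<close>
    have "dist (x' \<omega>) (x \<omega>) \<le> dist (x \<omega> - c *\<^sub>R g \<omega>) (x \<omega>)"
      using closest_point_lipschitz[of X "x \<omega> - c *\<^sub>R g \<omega>" "x \<omega>"] X
        closest_point_self[OF mem(1)[OF \<omega>]] by (auto simp: x'[OF \<omega>] g_def)
    then have "norm (x' \<omega> - x \<omega>) \<le> norm (c *\<^sub>R g \<omega>)"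
      by (simp add: dist_norm)
    then have "(norm (x' \<omega> - x \<omega>))\<^sup>2 \<le> (norm (c *\<^sub>R g \<omega>))\<^sup>2"
      by (rule power_mono) simp
    then show "(norm (x' \<omega> - x \<omega>))\<^sup>2 \<le> c\<^sup>2 * (norm (g \<omega>))\<^sup>2"
      by (simp add: power_mult_distrib)
  qed (use int g_sq in auto)
  also have "\<dots> \<le> c\<^sup>2 * B"
    using g_sq(2) by (simp add: mult_left_mono)
  finally show ?step .
qed

end

section \<open>Uniqueness, second moments, sources\<close>

text \<open>Two solutions, each tested at the other, add up to a contradiction with strict
  monotonicity.\<close>

lemma VI_solutions_eq_singleton:
  assumes "strictly_monotone_map_on X F" "s \<in> VI_solutions X F"
  shows "VI_solutions X F = {s}"
proof -
  have False if "t \<in> VI_solutions X F" "t \<noteq> s" for t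
  proof -
    have "s \<in> X" "t \<in> X" "0 \<le> F s \<bullet> (t - s)" "0 \<le> F t \<bullet> (s - t)"
      using that assms(2) by (auto simp: VI_solutions_def)
    moreover have "0 < (F t - F s) \<bullet> (t - s)"
      using assms(1) that calculation unfolding strictly_monotone_map_on_def by blast
    ultimately show False
      by (simp add: inner_diff_left inner_diff_right)
  qed
  then show ?thesis using assms(2) by blast
qed

text \<open>The cross term has mean zero. Applied to the noise it yields the second-moment bound
  \<open>C\<^sup>2 + \<nu>\<^sup>2\<close>.\<close>

lemma (in prob_space) mean_square_about_mean:
  fixes f :: "'a \<Rightarrow> 'b::euclidean_space"
  assumes mean: "has_bochner_integral M (\<lambda>\<omega>. f \<omega> - m) 0"
    and int: "integrable M (\<lambda>\<omega>. (norm (f \<omega> - m))\<^sup>2)"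
  shows "has_bochner_integral M (\<lambda>\<omega>. (norm (f \<omega>))\<^sup>2)
    (expectation (\<lambda>\<omega>. (norm (f \<omega> - m))\<^sup>2) + (norm m)\<^sup>2)"
proof -
  have "has_bochner_integral M (\<lambda>\<omega>. (norm (f \<omega> - m))\<^sup>2 + 2 * ((f \<omega> - m) \<bullet> m) + (norm m)\<^sup>2)
      (expectation (\<lambda>\<omega>. (norm (f \<omega> - m))\<^sup>2) + 2 * (0 \<bullet> m) + (norm m)\<^sup>2)"
  proof (intro has_bochner_integral_add has_bochner_integral_mult_right has_bochner_integral_inner_left)
    show "has_bochner_integral M (\<lambda>\<omega>. (norm m)\<^sup>2) ((norm m)\<^sup>2)"
      by (simp add: has_bochner_integral_iff prob_space)
  qed (use mean int in \<open>simp_all add: has_bochner_integral_iff\<close>)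
  moreover have "(norm (f \<omega> - m))\<^sup>2 + 2 * ((f \<omega> - m) \<bullet> m) + (norm m)\<^sup>2 = (norm (f \<omega>))\<^sup>2" for \<omega>
    by (simp add: power2_norm_eq_inner inner_diff_left inner_diff_right inner_commute)
  ultimately show ?thesis by simp
qed

lemma measurable_sigma_of_generated_events:
  fixes V :: "'w \<Rightarrow> 'a::topological_space"
  assumes "generated_events P V \<subseteq> A" "A \<subseteq> Pow (space P)"
  shows "V \<in> borel_measurable (sigma (space P) A)"
proof (rule measurableI)
  fix S :: "'a set" assume "S \<in> sets borel"
  then have "V -` S \<inter> space P \<in> generated_events P V"
    unfolding generated_events_def sets_vimage_algebra by blast
  then show "V -` S \<inter> space (sigma (space P) A) \<in> sets (sigma (space P) A)"
    using assms by (simp add: space_measure_of_conv subset_iff)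
qed simp

fun source_events ::
  "'w measure \<Rightarrow> ('w \<Rightarrow> real ^ 'n) \<Rightarrow> (nat \<Rightarrow> 'w \<Rightarrow> real ^ 'n) \<Rightarrow> (nat \<Rightarrow> 'w \<Rightarrow> real ^ 'n)
     \<Rightarrow> (nat \<Rightarrow> 'w \<Rightarrow> real ^ 'd) \<Rightarrow> (nat \<Rightarrow> 'w \<Rightarrow> real ^ 'd) \<Rightarrow> source \<Rightarrow> 'w set set" where
  "source_events P x0 z z' xi xi' Start = generated_events P x0"
| "source_events P x0 z z' xi xi' (Z t) = generated_events P (z t)"
| "source_events P x0 z z' xi xi' (Z' t) = generated_events P (z' t)"
| "source_events P x0 z z' xi xi' (Xi t) = generated_events P (xi t)"
| "source_events P x0 z z' xi xi' (Xi' t) = generated_events P (xi' t)"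

lemma independent_sources_iff:
  "independent_sources P x0 z z' xi xi'
    \<longleftrightarrow> prob_space.indep_sets P (source_events P x0 z z' xi xi') UNIV"
proof -
  have "source_events P x0 z z' xi xi' = (\<lambda>i. case i of
      Start \<Rightarrow> generated_events P x0 | Z t \<Rightarrow> generated_events P (z t)
    | Z' t \<Rightarrow> generated_events P (z' t) | Xi t \<Rightarrow> generated_events P (xi t)
    | Xi' t \<Rightarrow> generated_events P (xi' t))"
    by (rule ext) (auto split: source.split)
  then show ?thesis by (simp add: independent_sources_def)
qed

text \<open>A filtration encoded by index sets: these sources determine the iterate
  \<open>x t\<close>.\<close>

fun past :: "nat \<Rightarrow> source set" where
  "past 0 = {Start}"
| "past (Suc t) = past t \<union> {Z t, Z' t, Xi t, Xi' t}"

lemma not_in_past: "t \<le> s \<Longrightarrow> Z s \<notin> past t \<and> Z' s \<notin> past t \<and> Xi s \<notin> past t \<and> Xi' s \<notin> past t"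
  by (induction t) auto

section \<open>Convergence of the scheme\<close>

theorem theorem2:
  fixes P :: "'w measure"
    and \<xi> :: "'w \<Rightarrow> real ^ 'd"
    and X :: "(real ^ 'n) set"
    and \<Phi> :: "real ^ 'n \<Rightarrow> real ^ 'd \<Rightarrow> real ^ 'n"
    and F :: "real ^ 'n \<Rightarrow> real ^ 'n"
    and M C \<nu> \<alpha> \<beta> q \<epsilon> :: real
    and \<gamma> eps :: "nat \<Rightarrow> real"
    and z z' :: "nat \<Rightarrow> 'w \<Rightarrow> real ^ 'n"
    and xi xi' :: "nat \<Rightarrow> 'w \<Rightarrow> real ^ 'd"
    and x y :: "nat \<Rightarrow> 'w \<Rightarrow> real ^ 'n"
  assumes P: "prob_space P"
    and \<xi>: "\<xi> \<in> borel_measurable P"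
    and X_nonempty: "X \<noteq> {}"
    and eps_bound: "\<epsilon> > 0" "\<And>t. eps t \<le> \<epsilon>"
    and \<Phi>_measurable:
      "(\<lambda>(u, s). \<Phi> u s) \<in> borel_measurable (restrict_space borel (enlargement X \<epsilon>) \<Otimes>\<^sub>M borel)"
    and F_mean:
      "\<And>u. u \<in> enlargement X \<epsilon> \<Longrightarrow> has_bochner_integral P (\<lambda>\<omega>. \<Phi> u (\<xi> \<omega>)) (F u)"
    and x0: "x 0 \<in> borel_measurable P" "x 0 \<in> space P \<rightarrow> X"
      "integrable P (\<lambda>\<omega>. (norm (x 0 \<omega>))\<^sup>2)"
    and xi_samples: "\<And>t. sample_of P \<xi> (xi t)" "\<And>t. sample_of P \<xi> (xi' t)"
    and z_samples: "\<And>t. uniform_cube_sample P (z t) (eps t)"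
      "\<And>t. uniform_cube_sample P (z' t) (eps t)"
    and A_a: "closed X" "convex X" "M > 0" "\<And>u. u \<in> X \<Longrightarrow> norm u \<le> M"
    and A_b: "monotone_map_on (enlargement X \<epsilon>) F" "C > 0"
      "\<And>u. u \<in> enlargement X \<epsilon> \<Longrightarrow> norm (F u) \<le> C"
    and A_c: "\<exists>s\<in>X. \<forall>u\<in>X. (u - s) \<bullet> (\<integral>\<omega>. \<Phi> s (\<xi> \<omega>) \<partial>P) \<ge> 0"
    and A_d: "independent_sources P (x 0) z z' xi xi'"
    and B: "\<nu> > 0"
      "\<And>u. u \<in> enlargement X \<epsilon> \<Longrightarrow>
         has_bochner_integral P (\<lambda>\<omega>. \<Phi> u (\<xi> \<omega>) - F u) 0"
      "\<And>u. u \<in> enlargement X \<epsilon> \<Longrightarrow>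
         integrable P (\<lambda>\<omega>. (norm (\<Phi> u (\<xi> \<omega>) - F u))\<^sup>2)"
      "\<And>u. u \<in> enlargement X \<epsilon> \<Longrightarrow>
         (\<integral>\<omega>. (norm (\<Phi> u (\<xi> \<omega>) - F u))\<^sup>2 \<partial>P) \<le> \<nu>\<^sup>2"
    and strict: "strictly_monotone_map_on X F"
    and sharp: "\<alpha> > 0" "weakly_sharp X F \<alpha>"
    and \<beta>: "\<beta> > max (sqrt (5 * real CARD('n)) * C)
                      ((\<alpha>\<^sup>2 - 5 * (C\<^sup>2 + \<nu>\<^sup>2)) / (2 * sqrt (real CARD('n)) * C))"
    and q: "q = \<alpha> + 2 * C\<^sup>2 * \<alpha> + 2 * \<alpha> * \<nu>\<^sup>2
                  + 2 * (\<alpha> + 1) * \<beta> * sqrt (real CARD('n)) * C + 5 * (C\<^sup>2 + \<nu>\<^sup>2)"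
    and scheme:
      "\<And>t \<omega>. \<omega> \<in> space P \<Longrightarrow>
         y (Suc t) \<omega> = closest_point X (x t \<omega> - \<gamma> t *\<^sub>R \<Phi> (x t \<omega> + z' t \<omega>) (xi' t \<omega>))"
      "\<And>t \<omega>. \<omega> \<in> space P \<Longrightarrow>
         x (Suc t) \<omega> = closest_point X (x t \<omega> - \<gamma> t *\<^sub>R \<Phi> (y (Suc t) \<omega> + z t \<omega>) (xi t \<omega>))"
    and \<gamma>: "\<gamma> 0 = 2 * \<alpha> * M / q" "\<And>t. \<gamma> (Suc t) = \<gamma> t * (1 - \<alpha> / (2 * M) * \<gamma> t)"
    and eps: "eps 0 = 2 * \<alpha> * \<beta> * M / q"
      "\<And>t. eps (Suc t) = eps t * (1 - \<alpha> / (2 * \<beta> * M) * eps t)"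
  shows "(\<exists>!xs. xs \<in> VI_solutions X F) \<and>
    (\<forall>xs \<in> VI_solutions X F.
       (AE \<omega> in P. (\<lambda>t. x t \<omega>) \<longlonglongrightarrow> xs) \<and>
       (\<forall>t. integrable P (\<lambda>\<omega>. (norm (x t \<omega> - xs))\<^sup>2)) \<and>
       (\<lambda>t. \<integral>\<omega>. (norm (x t \<omega> - xs))\<^sup>2 \<partial>P) \<longlonglongrightarrow> 0 \<and>
       (\<forall>t\<ge>1. (\<integral>\<omega>. (norm (x t \<omega> - xs))\<^sup>2 \<partial>P) \<le> (4 * q * M\<^sup>2 / \<alpha>\<^sup>2) * (1 / real t)))"
proof -
  interpret prob_space P by (rule P)
  define E where "E = enlargement X \<epsilon>"
  \<comment> \<open>\<open>\<Phi>\<close> is measurable only on the enlarged set; its extension by zero is measurable everywhere.\<close>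
  define \<Psi> where "\<Psi> u s = (if u \<in> E then \<Phi> u s else 0)" for u s
  define G where "G = source_events P (x 0) z z' xi xi'"
  let ?sn = "sqrt (real CARD('n))"
  let ?B = "C\<^sup>2 + \<nu>\<^sup>2"

  have enlarge: "u + v \<in> E" if "u \<in> X" "v \<in> cube (eps t)" for u v t
    using that cube_mono[OF eps_bound(2)] unfolding E_def enlargement_def by blast
  have XE: "u \<in> E" if "u \<in> X" for u
  proof -
    have "0 \<in> (cube \<epsilon> :: (real ^ 'n) set)" using eps_bound(1) by (simp add: cube_def)
    with that have "u + 0 \<in> E" unfolding E_def enlargement_def by blast
    then show ?thesis by simp
  qed
  note mean = F_mean[folded E_def] and monotone = A_b(1)[folded E_def] and F_le = A_b(3)[folded E_def]
    and noise = B(2-4)[folded E_def]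

  obtain xs where xs: "xs \<in> VI_solutions X F"
  proof -
    obtain s where "s \<in> X" "\<And>u. u \<in> X \<Longrightarrow> (u - s) \<bullet> (\<integral>\<omega>. \<Phi> s (\<xi> \<omega>) \<partial>P) \<ge> 0"
      using A_c by blast
    with has_bochner_integral_integral_eq[OF mean[OF XE[OF \<open>s \<in> X\<close>]]] have "s \<in> VI_solutions X F"
      by (simp add: VI_solutions_def inner_commute)
    then show thesis by (rule that)
  qed
  note sol = VI_solutions_eq_singleton[OF strict xs]
  have xsX: "xs \<in> X" using xs by (simp add: VI_solutions_def)
  have sharp': "\<alpha> * norm (a - xs) \<le> F xs \<bullet> (a - xs)" if "a \<in> X" for a
    using sharp(2) that unfolding weakly_sharp_def sol by (simp add: dist_norm)

  have x_mem: "x t \<omega> \<in> X" if "\<omega> \<in> space P" for t \<omega>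
    using x0(2) that A_a by (cases t) (auto simp: scheme(2) intro!: closest_point_in_set)
  have y_mem: "y (Suc t) \<omega> \<in> X" if "\<omega> \<in> space P" for t \<omega>
    using that A_a X_nonempty by (simp add: scheme(1) closest_point_in_set)
  have z_mem: "z t \<omega> \<in> cube (eps t)" "z' t \<omega> \<in> cube (eps t)" if "\<omega> \<in> space P" for t \<omega>
    using z_samples[of t] that by (auto simp: uniform_cube_sample_def)
  \<comment> \<open>Perturbations lie in \<open>cube (eps t)\<close> at every sample point and
    \<open>eps t\<close> is at most \<open>\<epsilon>\<close>, so all queries fall in
    \<open>E\<close>, where \<open>\<Psi>\<close> and \<open>\<Phi>\<close> agree.\<close>
  have scheme': "y (Suc t) \<omega> = closest_point X (x t \<omega> - \<gamma> t *\<^sub>R \<Psi> (x t \<omega> + z' t \<omega>) (xi' t \<omega>))"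
      "x (Suc t) \<omega> = closest_point X (x t \<omega> - \<gamma> t *\<^sub>R \<Psi> (y (Suc t) \<omega> + z t \<omega>) (xi t \<omega>))"
    if "\<omega> \<in> space P" for t \<omega>
    using scheme[OF that] enlarge[OF x_mem[OF that] z_mem(2)[OF that]]
      enlarge[OF y_mem[OF that] z_mem(1)[OF that]] by (simp_all add: \<Psi>_def)

  have \<Psi>_measurable [measurable]: "(\<lambda>(u, s). \<Psi> u s) \<in> borel_measurable (borel \<Otimes>\<^sub>M borel)"
  proof -
    have "E \<in> sets borel"
      unfolding E_def by (intro borel_closed closed_enlargement A_a)
    then have EU: "{p \<in> space (borel \<Otimes>\<^sub>M (borel :: (real ^ 'd) measure)). fst p \<in> E}
        \<in> sets (borel \<Otimes>\<^sub>M borel)"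
      by measurable
    have "(\<lambda>p. (fst p, snd p)) \<in> restrict_space (borel \<Otimes>\<^sub>M borel) {p. fst p \<in> E}
        \<rightarrow>\<^sub>M restrict_space borel E \<Otimes>\<^sub>M (borel :: (real ^ 'd) measure)"
      by (intro measurable_Pair measurable_restrict_space2)
        (auto simp: space_restrict_space intro: measurable_restrict_space1)
    from measurable_compose[OF this \<Phi>_measurable[folded E_def]]
    have "(\<lambda>p. if fst p \<in> E then \<Phi> (fst p) (snd p) else 0) \<in> borel_measurable (borel \<Otimes>\<^sub>M borel)"
      by (subst measurable_If_restrict_space_iff[OF EU]) (simp add: case_prod_beta)
    then show ?thesis by (simp add: \<Psi>_def case_prod_beta)
  qed
  interpret mapping: stochastic_mapping P \<xi> \<Psi> E F ?B
  proof
    fix u assume u: "u \<in> E"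
    note square = mean_square_about_mean[OF noise(1,2)[OF u]]
    show "has_bochner_integral P (\<lambda>\<omega>. \<Psi> u (\<xi> \<omega>)) (F u)"
      using mean[OF u] u by (simp add: \<Psi>_def)
    show "integrable P (\<lambda>\<omega>. (norm (\<Psi> u (\<xi> \<omega>)))\<^sup>2)"
      using square u by (simp add: \<Psi>_def has_bochner_integral_iff)
    have "(norm (F u))\<^sup>2 \<le> C\<^sup>2"
      using F_le[OF u] by (simp add: power_mono)
    then show "expectation (\<lambda>\<omega>. (norm (\<Psi> u (\<xi> \<omega>)))\<^sup>2) \<le> ?B"
      using square noise(3)[OF u] u by (simp add: \<Psi>_def has_bochner_integral_iff)
  qed (use \<xi> in auto)

  \<comment> \<open>Measurability and independence of the iterates\<close>
  have indep: "indep_sets G UNIV"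
    using A_d unfolding G_def independent_sources_iff .
  have G_sub: "G i \<subseteq> Pow (space P)" for i
    using indep sets.space_closed[of P] by (auto simp: indep_sets_def)
  have G_Int_stable: "Int_stable (G i)" for i
    unfolding G_def by (cases i) (simp_all add: generated_events_def sets.Int_stable)
  define \<H> where "\<H> I = sigma (space P) (\<Union>i\<in>I. G i)" for I
  have space_\<H> [simp]: "space (\<H> I) = space P" for I
    by (simp add: \<H>_def space_measure_of_conv)
  have \<H>_mono: "f \<in> borel_measurable (\<H> J)" if "f \<in> borel_measurable (\<H> I)" "I \<subseteq> J"
    for f :: "'w \<Rightarrow> real ^ 'n" and I J
  proof (rule measurable_from_subalg[OF _ that(1)])
    have "sigma_sets (space P) (\<Union>i\<in>I. G i) \<subseteq> sigma_sets (space P) (\<Union>i\<in>J. G i)"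
      using that(2) by (intro sigma_sets_mono') blast
    then show "subalgebra (\<H> J) (\<H> I)"
      using G_sub by (simp add: subalgebra_def \<H>_def UN_least)
  qed
  have \<H>_source: "V \<in> borel_measurable (\<H> I)" if "i \<in> I" "G i = generated_events P V"
    for V :: "'w \<Rightarrow> 'z::topological_space" and i I
    unfolding \<H>_def using that G_sub by (intro measurable_sigma_of_generated_events) auto
  have sources: "Start \<in> I \<Longrightarrow> x 0 \<in> borel_measurable (\<H> I)"
      "Z t \<in> I \<Longrightarrow> z t \<in> borel_measurable (\<H> I)" "Z' t \<in> I \<Longrightarrow> z' t \<in> borel_measurable (\<H> I)"
      "Xi t \<in> I \<Longrightarrow> xi t \<in> borel_measurable (\<H> I)" "Xi' t \<in> I \<Longrightarrow> xi' t \<in> borel_measurable (\<H> I)"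
    for I t
    by (auto intro!: \<H>_source simp: G_def)
  have proj [measurable]: "closest_point X \<in> borel_measurable borel"
    using A_a X_nonempty by (intro borel_measurable_continuous_onI continuous_on_closest_point)
  have step_measurable: "w \<in> borel_measurable (\<H> I)"
    if [measurable]: "a \<in> borel_measurable (\<H> I)" "b \<in> borel_measurable (\<H> I)"
      "c \<in> borel_measurable (\<H> I)" "v \<in> borel_measurable (\<H> I)"
      and w: "\<And>\<omega>. \<omega> \<in> space P \<Longrightarrow> w \<omega> = closest_point X (a \<omega> - k *\<^sub>R \<Psi> (b \<omega> + c \<omega>) (v \<omega>))"
    for w a b c v k I
  proof -
    have "(\<lambda>\<omega>. closest_point X (a \<omega> - k *\<^sub>R \<Psi> (b \<omega> + c \<omega>) (v \<omega>))) \<in> borel_measurable (\<H> I)"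
      by measurable
    then show ?thesis
      by (rule measurable_cong[THEN iffD2, rotated]) (simp add: w)
  qed
  \<comment> \<open>The half step consumes only \<open>Z' t\<close> and \<open>Xi' t\<close>, which
    leaves \<open>Z t\<close> and \<open>Xi t\<close> fresh.\<close>
  have y_\<H>: "y (Suc t) \<in> borel_measurable (\<H> (past t \<union> {Z' t, Xi' t}))"
    if "x t \<in> borel_measurable (\<H> (past t))" for t
    by (rule step_measurable[OF _ _ _ _ scheme'(1)]) (auto intro: \<H>_mono[OF that] sources)
  have x_\<H>: "x t \<in> borel_measurable (\<H> (past t))" for t
  proof (induction t)
    case 0
    show ?case by (rule sources(1)) simp
  next
    case (Suc t)
    show ?case
      by (rule step_measurable[OF _ _ _ _ scheme'(2)])
        (auto intro: \<H>_mono[OF Suc] \<H>_mono[OF y_\<H>[OF Suc]] sources)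
  qed
  have joint: "random_variable borel a" "random_variable borel b" "random_variable borel v"
      "distr P ((borel \<Otimes>\<^sub>M borel) \<Otimes>\<^sub>M borel) (\<lambda>\<omega>. ((a \<omega>, b \<omega>), v \<omega>))
        = distr P (borel \<Otimes>\<^sub>M borel) (\<lambda>\<omega>. (a \<omega>, b \<omega>)) \<Otimes>\<^sub>M distr P borel v"
    if [measurable]: "a \<in> borel_measurable (\<H> I)" "b \<in> borel_measurable (\<H> I)"
      and v: "G j = generated_events P v" and j: "j \<notin> I"
    for a b :: "'w \<Rightarrow> real ^ 'n" and v :: "'w \<Rightarrow> real ^ 'd" and I j
  proof -
    have ab: "(\<lambda>\<omega>. (a \<omega>, b \<omega>)) \<in> sigma (space P) (\<Union>i\<in>I. G i) \<rightarrow>\<^sub>M borel \<Otimes>\<^sub>M borel"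
      unfolding \<H>_def[symmetric] by measurable
    have v': "v \<in> sigma (space P) (G j) \<rightarrow>\<^sub>M borel"
      using v G_sub[of j] by (intro measurable_sigma_of_generated_events) auto
    note rules = indep G_Int_stable _ v' j
    note random_variable = random_variable_of_indep_sigma_algebras[OF rules]
    show "distr P ((borel \<Otimes>\<^sub>M borel) \<Otimes>\<^sub>M borel) (\<lambda>\<omega>. ((a \<omega>, b \<omega>), v \<omega>))
        = distr P (borel \<Otimes>\<^sub>M borel) (\<lambda>\<omega>. (a \<omega>, b \<omega>)) \<Otimes>\<^sub>M distr P borel v"
      by (rule distr_pair_of_indep_sigma_algebras[OF rules]) (rule ab)
    show "random_variable borel a" "random_variable borel b"
      using that(1,2) unfolding \<H>_def by (auto intro: random_variable(1))
    show "random_variable borel v"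
      by (rule random_variable(2)) (rule ab)
  qed
  have joint_y: "random_variable borel (y (Suc t))" "random_variable borel (z t)"
      "random_variable borel (xi t)"
      "distr P ((borel \<Otimes>\<^sub>M borel) \<Otimes>\<^sub>M borel) (\<lambda>\<omega>. ((y (Suc t) \<omega>, z t \<omega>), xi t \<omega>))
        = distr P (borel \<Otimes>\<^sub>M borel) (\<lambda>\<omega>. (y (Suc t) \<omega>, z t \<omega>)) \<Otimes>\<^sub>M distr P borel (xi t)" for t
  proof -
    \<comment> \<open>Large enough to determine both \<open>y (Suc t)\<close> and
      \<open>z t\<close>, yet without \<open>Xi t\<close>, the sample used at their sum.\<close>
    let ?I = "past t \<union> {Z t, Z' t, Xi' t}"
    have y: "y (Suc t) \<in> borel_measurable (\<H> ?I)"
      by (rule \<H>_mono[OF y_\<H>[OF x_\<H>]]) auto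
    have z: "z t \<in> borel_measurable (\<H> ?I)"
      by (rule sources(2)) simp
    have xi: "G (Xi t) = generated_events P (xi t)" "Xi t \<notin> ?I"
      using not_in_past[of t t] by (simp_all add: G_def)
    from joint[OF y z xi] show "random_variable borel (y (Suc t))" "random_variable borel (z t)"
      "random_variable borel (xi t)"
      "distr P ((borel \<Otimes>\<^sub>M borel) \<Otimes>\<^sub>M borel) (\<lambda>\<omega>. ((y (Suc t) \<omega>, z t \<omega>), xi t \<omega>))
        = distr P (borel \<Otimes>\<^sub>M borel) (\<lambda>\<omega>. (y (Suc t) \<omega>, z t \<omega>)) \<Otimes>\<^sub>M distr P borel (xi t)" .
  qed
  have joint_x: "random_variable borel (x t)" "random_variable borel (z' t)"
      "random_variable borel (xi' t)"
      "distr P ((borel \<Otimes>\<^sub>M borel) \<Otimes>\<^sub>M borel) (\<lambda>\<omega>. ((x t \<omega>, z' t \<omega>), xi' t \<omega>))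
        = distr P (borel \<Otimes>\<^sub>M borel) (\<lambda>\<omega>. (x t \<omega>, z' t \<omega>)) \<Otimes>\<^sub>M distr P borel (xi' t)" for t
  proof -
    let ?I = "past t \<union> {Z' t}"
    have x: "x t \<in> borel_measurable (\<H> ?I)"
      by (rule \<H>_mono[OF x_\<H>]) auto
    have z': "z' t \<in> borel_measurable (\<H> ?I)"
      by (rule sources(3)) simp
    have xi': "G (Xi' t) = generated_events P (xi' t)" "Xi' t \<notin> ?I"
      using not_in_past[of t t] by (simp_all add: G_def)
    from joint[OF x z' xi'] show "random_variable borel (x t)" "random_variable borel (z' t)"
      "random_variable borel (xi' t)"
      "distr P ((borel \<Otimes>\<^sub>M borel) \<Otimes>\<^sub>M borel) (\<lambda>\<omega>. ((x t \<omega>, z' t \<omega>), xi' t \<omega>))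
        = distr P (borel \<Otimes>\<^sub>M borel) (\<lambda>\<omega>. (x t \<omega>, z' t \<omega>)) \<Otimes>\<^sub>M distr P borel (xi' t)" .
  qed

  \<comment> \<open>Constants, recursion and rate\<close>
  have "0 \<le> ?sn * (sqrt 5 * C)" using A_b(2) by simp
  then have \<beta>0: "\<beta> > 0" using \<beta> by (simp add: real_sqrt_mult mult_ac)
  \<comment> \<open>Drops the nonnegative summands of \<open>q\<close> that carry a factor
    \<open>\<alpha>\<close>.\<close>
  have q_ge: "2 * \<beta> * ?sn * C + 5 * ?B \<le> q"
    using sharp(1) \<beta>0 A_b(2) by (simp add: q algebra_simps)
  moreover have "0 \<le> 2 * \<beta> * ?sn * C" using \<beta>0 A_b(2) by simp
  ultimately have q5: "5 * C\<^sup>2 \<le> q"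
    using zero_le_power2[of \<nu>] by (simp only: distrib_left)
  moreover have "0 < C\<^sup>2" using A_b(2) by simp
  ultimately have q0: "0 < q" by linarith

  let ?D = "\<lambda>t. expectation (\<lambda>\<omega>. (norm (x t \<omega> - xs))\<^sup>2)"
  have sq_le: "(norm (x t \<omega> - xs))\<^sup>2 \<le> 4 * M\<^sup>2" if "\<omega> \<in> space P" for t \<omega>
  proof -
    have "norm (x t \<omega> - xs) \<le> 2 * M"
      using norm_triangle_ineq4[of "x t \<omega>" xs] A_a(4)[OF x_mem[OF that, of t]] A_a(4)[OF xsX] by linarith
    from power_mono[OF this, of 2] show ?thesis by simp
  qed
  have sq_int: "integrable P (\<lambda>\<omega>. (norm (x t \<omega> - xs))\<^sup>2)" for t
    using joint_x(1)[of t] sq_le by (intro integrable_const_bound[of _ "4 * M\<^sup>2"]) auto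
  have goal: "(AE \<omega> in P. (\<lambda>t. x t \<omega>) \<longlonglongrightarrow> xs) \<and>
    (\<forall>t\<ge>1. ?D t \<le> (4 * q * M\<^sup>2 / \<alpha>\<^sup>2) * (1 / real t))"
  proof (cases "\<alpha> \<le> C")
    case False
    have "a = xs" if "a \<in> X" for a
    proof (rule ccontr)
      assume "a \<noteq> xs"
      have "\<alpha> * norm (a - xs) \<le> norm (F xs) * norm (a - xs)"
        using sharp'[OF that] norm_cauchy_schwarz[of "F xs" "a - xs"] by linarith
      then show False
        using F_le[OF XE[OF xsX]] False \<open>a \<noteq> xs\<close> by simp
    qed
    then have eq: "x t \<omega> = xs" if "\<omega> \<in> space P" for t \<omega>
      using x_mem[OF that] by blast
    then have "?D t = 0" for t
      by (subst Bochner_Integration.integral_cong[where g = "\<lambda>_. 0"]) auto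
    then show ?thesis
      using q0 eq by (auto intro!: AE_I2)
  next
    case True
    \<comment> \<open>Sharpness and the bound on \<open>F\<close> give \<open>\<alpha> \<le> C\<close> unless \<open>X\<close> is a point; this keeps
      \<open>a 0 \<le> 1 / 5\<close>, so the factor \<open>1 - 2 * a t\<close> in the recursion below is nonnegative.\<close>
    define a where "a t = \<alpha> / (2 * M) * \<gamma> t" for t
    have \<gamma>_eq: "\<gamma> t = 2 * M / \<alpha> * a t" for t
      using A_a(3) sharp(1) by (simp add: a_def)
    have a0: "a 0 = \<alpha>\<^sup>2 / q"
      using A_a(3) by (simp add: a_def \<gamma>(1) power2_eq_square)
    have "5 * \<alpha>\<^sup>2 \<le> q"
      using q5 power_mono[OF True, of 2] sharp(1) by simp
    then have a0_le: "a 0 \<le> 1 / 5" "0 < a 0"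
      using q0 sharp(1) by (simp_all add: a0 field_simps)
    \<comment> \<open>The rescaling \<open>a\<close> turns the stepsize recursion into the logistic
      map.\<close>
    have a_Suc: "a (Suc t) = a t * (1 - a t)" for t
      by (simp add: a_def \<gamma>(2))
    note a = logistic_decay[of a, OF a0_le(2) _ a_Suc]
    have a_pos: "0 < a t" and a_le: "a t \<le> 1 / 5" "a t \<le> 1 / (real t + 1)" for t
      using a[of t] a0_le by auto
    have a_inv: "a t \<le> 1 / real t" if "t \<ge> 1" for t
      using that by (intro order_trans[OF a_le(2)] divide_left_mono) auto
    have \<gamma>_pos: "0 < \<gamma> t" for t
      unfolding \<gamma>_eq using a_pos A_a(3) sharp(1) by simp
    have eps_eq: "eps t = \<beta> * \<gamma> t" for t
    proof (induction t)
      case 0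
      show ?case by (simp add: eps(1) \<gamma>(1))
    next
      case (Suc t)
      then show ?case using \<beta>0 by (simp add: eps(2) \<gamma>(2))
    qed
    have drift: "(norm (x t \<omega> - xs))\<^sup>2 - (norm (x t \<omega> - y (Suc t) \<omega>))\<^sup>2
          + 2 * \<gamma> t * (F (y (Suc t) \<omega> + z t \<omega>) \<bullet> (xs - y (Suc t) \<omega>))
        \<le> (1 - 2 * a t) * (norm (x t \<omega> - xs))\<^sup>2 + (\<gamma> t)\<^sup>2 * (C\<^sup>2 + 2 * \<beta> * ?sn * C)"
      if \<omega>: "\<omega> \<in> space P" for t \<omega>
    proof -
      have "norm (z t \<omega>) \<le> ?sn * eps t / 2"
        by (intro norm_le_of_mem_cube z_mem \<omega>)
      then have "(norm (x t \<omega> - xs))\<^sup>2 - (norm (x t \<omega> - y (Suc t) \<omega>))\<^sup>2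
          + 2 * \<gamma> t * (F (y (Suc t) \<omega> + z t \<omega>) \<bullet> (xs - y (Suc t) \<omega>))
        \<le> (1 - \<alpha> * \<gamma> t / M) * (norm (x t \<omega> - xs))\<^sup>2
          + ((\<gamma> t)\<^sup>2 * C\<^sup>2 + 4 * \<gamma> t * C * (?sn * eps t / 2))"
        using True sharp(1) \<gamma>_pos[of t] A_a(3) A_a(4)[OF x_mem[OF \<omega>]] A_a(4)[OF xsX]
        by (intro sharp_monotone_drift[OF monotone F_le XE[OF xsX]
              enlarge[OF y_mem[OF \<omega>] z_mem(1)[OF \<omega>]] sharp'[OF y_mem[OF \<omega>]]]) auto
      \<comment> \<open>With \<open>eps t = \<beta> * \<gamma> t\<close> the smoothing error becomes
        quadratic in \<open>\<gamma> t\<close>.\<close>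
      also have "\<dots> = (1 - 2 * a t) * (norm (x t \<omega> - xs))\<^sup>2 + (\<gamma> t)\<^sup>2 * (C\<^sup>2 + 2 * \<beta> * ?sn * C)"
        by (simp add: a_def eps_eq power2_eq_square algebra_simps)
      finally show ?thesis .
    qed
    note step = mapping.expected_extragradient_step[where v = "xi t" and v' = "xi' t" for t,
      OF A_a(1,2) xsX A_a(4) joint_x(1) joint_y(1) joint_x(1) joint_y(2) joint_x(2) joint_y(3) joint_x(3)
        _ _ joint_y(4) joint_x(4) x_mem enlarge[OF x_mem z_mem(2)] enlarge[OF y_mem z_mem(1)] scheme' drift]
    have same: "distr P borel (xi t) = distr P borel \<xi>" "distr P borel (xi' t) = distr P borel \<xi>" for t
      using xi_samples[of t] by (simp_all add: sample_of_def)
    have D_Suc: "?D (Suc t) \<le> (1 - 2 * a t) * ?D t + q * (\<gamma> t)\<^sup>2" for t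
    proof -
      have "?D (Suc t) \<le> (1 - 2 * a t) * ?D t + (\<gamma> t)\<^sup>2 * (C\<^sup>2 + 2 * \<beta> * ?sn * C) + 4 * (\<gamma> t)\<^sup>2 * ?B"
        by (rule step(1)) (simp_all add: same)
      also have "\<dots> = (1 - 2 * a t) * ?D t + (\<gamma> t)\<^sup>2 * (2 * \<beta> * ?sn * C + C\<^sup>2 + 4 * ?B)"
        by (simp add: algebra_simps)
      \<comment> \<open>Sampling contributes four copies of
        \<open>C\<^sup>2 + \<nu>\<^sup>2\<close>, and the \<open>C\<^sup>2\<close> of the drift is
        covered by the fifth in \<open>q\<close>.\<close>
      also have "\<dots> \<le> (1 - 2 * a t) * ?D t + (\<gamma> t)\<^sup>2 * q"
      proof (intro add_left_mono mult_left_mono)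
        show "2 * \<beta> * ?sn * C + C\<^sup>2 + 4 * ?B \<le> q"
          using q_ge zero_le_power2[of \<nu>] by (simp only: distrib_left)
      qed simp
      finally show ?thesis by (simp add: mult.commute)
    qed
    have D_le: "?D t \<le> 4 * q * M\<^sup>2 / \<alpha>\<^sup>2 * a t" for t
    proof (induction t)
      case 0
      have "?D 0 \<le> expectation (\<lambda>_. 4 * M\<^sup>2)"
        using sq_int sq_le by (intro integral_mono) auto
      \<comment> \<open>The initial stepsize makes \<open>a 0 = \<alpha>\<^sup>2 / q\<close>, so the
        claimed bound starts exactly at the trivial one, \<open>4 * M\<^sup>2\<close>.\<close>
      also have "\<dots> = 4 * q * M\<^sup>2 / \<alpha>\<^sup>2 * a 0"
        using q0 sharp(1) by (simp add: a0 prob_space)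
      finally show ?case .
    next
      case (Suc t)
      define K where "K = 4 * q * M\<^sup>2 / \<alpha>\<^sup>2"
      have "q * (\<gamma> t)\<^sup>2 = K * (a t)\<^sup>2"
        by (simp add: K_def \<gamma>_eq power_mult_distrib power_divide)
      moreover have "(1 - 2 * a t) * ?D t \<le> (1 - 2 * a t) * (K * a t)"
        using a_le[of t] by (intro mult_left_mono Suc[folded K_def]) auto
      ultimately have "?D (Suc t) \<le> (1 - 2 * a t) * (K * a t) + K * (a t)\<^sup>2"
        using D_Suc[of t] by linarith
      \<comment> \<open>\<open>(1 - 2 * a t) * a t + (a t)\<^sup>2\<close> is
        \<open>a t * (1 - a t)\<close>, the next normalised stepsize.\<close>
      also have "\<dots> = K * a (Suc t)"
        by (simp add: a_Suc power2_eq_square algebra_simps)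
      finally show ?case by (simp only: K_def)
    qed
    have rate: "?D t \<le> 4 * q * M\<^sup>2 / \<alpha>\<^sup>2 * (1 / real t)" if "t \<ge> 1" for t
    proof -
      have "4 * q * M\<^sup>2 / \<alpha>\<^sup>2 * a t \<le> 4 * q * M\<^sup>2 / \<alpha>\<^sup>2 * (1 / real t)"
        using q0 a_inv[OF that] by (intro mult_left_mono) auto
      with D_le[of t] show ?thesis by linarith
    qed
    have "AE \<omega> in P. (\<lambda>t. x t \<omega>) \<longlonglongrightarrow> xs"
    proof (rule AE_tendsto_of_mean_square_rates)
      show "?D t \<le> (4 * q * M\<^sup>2 / \<alpha>\<^sup>2) / real t" if "t \<ge> 1" for t
        using rate[OF that] by simp
      show "integrable P (\<lambda>\<omega>. (norm (x (Suc t) \<omega> - x t \<omega>))\<^sup>2)" for t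
        by (rule step(2)) (simp_all add: same)
      show "expectation (\<lambda>\<omega>. (norm (x (Suc t) \<omega> - x t \<omega>))\<^sup>2) \<le> (2 * M / \<alpha>)\<^sup>2 * ?B / (real t)\<^sup>2"
        if "t \<ge> 1" for t
      proof -
        have "expectation (\<lambda>\<omega>. (norm (x (Suc t) \<omega> - x t \<omega>))\<^sup>2) \<le> (\<gamma> t)\<^sup>2 * ?B"
          by (rule step(3)) (simp_all add: same)
        also have "\<dots> \<le> (2 * M / \<alpha> * (1 / real t))\<^sup>2 * ?B"
        proof (intro mult_right_mono power_mono)
          show "\<gamma> t \<le> 2 * M / \<alpha> * (1 / real t)"
            unfolding \<gamma>_eq using A_a(3) sharp(1) a_inv[OF that] by (intro mult_left_mono) auto
        qed (use \<gamma>_pos[of t] in auto)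
        also have "\<dots> = (2 * M / \<alpha>)\<^sup>2 * ?B / (real t)\<^sup>2"
          by (simp add: power_mult_distrib power_divide)
        finally show ?thesis .
      qed
    qed (rule sq_int)
    with rate show ?thesis by blast
  qed
  have "(\<lambda>t. 4 * q * M\<^sup>2 / \<alpha>\<^sup>2 * (1 / real t)) \<longlonglongrightarrow> 0"
    by (intro tendsto_mult_right_zero lim_1_over_n)
  then have "?D \<longlonglongrightarrow> 0"
    using goal by (rule_tac tendsto_sandwich[OF _ _ tendsto_const])
      (auto simp: eventually_sequentially simp del: One_nat_def)
  with goal sq_int show ?thesis unfolding sol by simp
qed

end
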